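(* Let $J\subset\mathbb R$ be a compact interval, $t_0\in J$, $V$ a finite-dimensional vector space, $\gamma>1/2$, and $\theta\in(0,1)$ with $(1+\theta)\gamma>1$. For every $X\in\mathcal C^\gamma(J,V)$, $y\in V$ and $\varphi\in C^{1,\theta}(V,V\otimes V^* )$ there exists a unique $Y\in\mathcal C^\gamma(J,V)$ such that $$Y^\mu_t=y^\mu+\int_{t_0}^t\varphi(Y_u)^\mu_\nu\,dX^\nu_u\qquad\text{for every }t\in J$$ (Young integral). Denote it $F(y,\varphi,X)$. The map $F$ is Lipschitz in the following sense: for $X,\widetilde X\in\mathcal C^\gamma(J,V)$, $y,\widetilde y\in V$ and $\varphi,\widetilde\varphi\in C^{1,\theta}(V,V\otimes V^* )$, $$\|F(y,\varphi,X)-F(\widetilde y,\widetilde\varphi,\widetilde X)\|_{\gamma,J}\le M\big(\|X-\widetilde X\|_{\gamma,J}+\|\varphi-\widetilde\varphi\|_{1,\theta}+|y-\widetilde y|\big)$$ for some constant $M$ depending only on $\|X\|_{\gamma,J}$, $\|\widetilde X\|_{\gamma,J}$, $\|\varphi\|_{1,\theta}$, $\|\widetilde\varphi\|_{1,\theta}$ and $J$.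
   Context: Repeated indices are summed. $\mathcal C^\gamma(J,U)$ is the space of continuous $f:J\to U$ with $\|f\|_{\gamma,J}:=\sup_{s\neq t\in J}|f_t-f_s|/|t-s|^\gamma<\infty$. $C^{1,\theta}(V,U)$ is the space of differentiable maps $\varphi:V\to U$ with finite norm $\|\varphi\|_{1,\theta}=\sup_V|\varphi|+\sup_V|\partial\varphi|+\sup_{x\neq y}|\partial\varphi(x)-\partial\varphi(y)|/|x-y|^\theta$. For real-valued $F\in\mathcal C^\rho(J)$, $G\in\mathcal C^{\gamma}(J)$ with $\rho+\gamma>1$, the Young integral is $\int_s^tF_u\,dG_u:=F_s(G_t-G_s)-R_{st}$, where $R$ is the unique continuous function on $J^2$ with $|R_{st}|\le M'|t-s|^{\rho+\gamma}$ for some $M'$ and $R_{st}-R_{ut}-R_{su}=-(F_u-F_s)(G_t-G_u)$ for all $s,u,t\in J$; equivalently, for $s\le t$, it is the limit of the Riemann sums $\sum_iF_{t_i}(G_{t_{i+1}}-G_{t_i})$ as the mesh tends to $0$. Here it is applied componentwise with $F=\varphi(Y)^\mu_\nu$ and $G=X^\nu$. *)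

theory Defs
  imports "HOL-Analysis.Analysis"
begin

(* The inserted 0 gives the value 0 to the supremum over the empty set, i.e. when S has at most
   one point (for real sets, Sup {} is unspecified). *)
definition holder_seminorm ::
    "real \<Rightarrow> 'm::metric_space set \<Rightarrow> ('m \<Rightarrow> 'u::real_normed_vector) \<Rightarrow> real" where
  "holder_seminorm \<gamma> S f =
     Sup (insert 0 {norm (f t - f s) / dist t s powr \<gamma> | s t. s \<in> S \<and> t \<in> S \<and> s \<noteq> t})"

definition holder_bounded ::
    "real \<Rightarrow> 'm::metric_space set \<Rightarrow> ('m \<Rightarrow> 'u::real_normed_vector) \<Rightarrow> bool" where
  "holder_bounded \<gamma> S f \<longleftrightarrow>
     bdd_above {norm (f t - f s) / dist t s powr \<gamma> | s t. s \<in> S \<and> t \<in> S \<and> s \<noteq> t}"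

(* Maps J \<rightarrow> U are represented by the functions that are undefined outside J, so that equality of
   elements is equality on J. *)
definition holder_space :: "real \<Rightarrow> real set \<Rightarrow> (real \<Rightarrow> 'u::real_normed_vector) set" where
  "holder_space \<gamma> J = {f \<in> extensional J. continuous_on J f \<and> holder_bounded \<gamma> J f}"

definition fderiv ::
    "('v::real_normed_vector \<Rightarrow> 'u::real_normed_vector) \<Rightarrow> 'v \<Rightarrow> 'v \<Rightarrow>\<^sub>L 'u" where
  "fderiv \<phi> x = Blinfun (frechet_derivative \<phi> (at x))"

definition C1_holder ::
    "real \<Rightarrow> ('v::real_normed_vector \<Rightarrow> 'u::real_normed_vector) set" where
  "C1_holder \<theta> =
     {\<phi>. (\<forall>x. \<phi> differentiable (at x)) \<and>
          bdd_above (range (\<lambda>x. norm (\<phi> x))) \<and>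
          bdd_above (range (\<lambda>x. norm (fderiv \<phi> x))) \<and>
          holder_bounded \<theta> UNIV (fderiv \<phi>)}"

definition C1_holder_norm ::
    "real \<Rightarrow> ('v::real_normed_vector \<Rightarrow> 'u::real_normed_vector) \<Rightarrow> real" where
  "C1_holder_norm \<theta> \<phi> =
     (SUP x. norm (\<phi> x)) + (SUP x. norm (fderiv \<phi> x)) + holder_seminorm \<theta> UNIV (fderiv \<phi>)"

definition young_remainder ::
    "real \<Rightarrow> real \<Rightarrow> real set \<Rightarrow> (real \<Rightarrow> real) \<Rightarrow> (real \<Rightarrow> real) \<Rightarrow> (real \<Rightarrow> real \<Rightarrow> real) \<Rightarrow> bool" where
  "young_remainder \<rho> \<gamma> J F G R \<longleftrightarrow>
     continuous_on (J \<times> J) (\<lambda>(s, t). R s t) \<and>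
     (\<exists>M'. \<forall>s\<in>J. \<forall>t\<in>J. \<bar>R s t\<bar> \<le> M' * \<bar>t - s\<bar> powr (\<rho> + \<gamma>)) \<and>
     (\<forall>s\<in>J. \<forall>u\<in>J. \<forall>t\<in>J. R s t - R u t - R s u = - (F u - F s) * (G t - G u))"

(* The remainder is determined on J \<times> J only, so the description picks the real value at (s, t)
   rather than the function R. It is meaningful for F in C^\<rho>(J), G in C^\<gamma>(J), \<rho> + \<gamma> > 1 and s, t in J. *)
definition young_integral ::
    "real \<Rightarrow> real \<Rightarrow> real set \<Rightarrow> (real \<Rightarrow> real) \<Rightarrow> (real \<Rightarrow> real) \<Rightarrow> real \<Rightarrow> real \<Rightarrow> real" where
  "young_integral \<rho> \<gamma> J F G s t =
     F s * (G t - G s) - (THE r. \<exists>R. young_remainder \<rho> \<gamma> J F G R \<and> r = R s t)"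

(* V \<otimes> V* is identified with the endomorphisms of V (with the operator norm); in the orthonormal
   basis Basis the component of A in row i, column j is (blinfun_apply A j) \<bullet> i. Since \<phi> is Lipschitz,
   the integrand is \<gamma>-Hoelder for Y in C^\<gamma>, hence the Young integral with both exponents \<gamma>. *)
definition young_solution ::
    "real \<Rightarrow> real set \<Rightarrow> real \<Rightarrow> 'v::euclidean_space \<Rightarrow> ('v \<Rightarrow> 'v \<Rightarrow>\<^sub>L 'v) \<Rightarrow> (real \<Rightarrow> 'v)
      \<Rightarrow> (real \<Rightarrow> 'v) \<Rightarrow> bool" where
  "young_solution \<gamma> J t0 y \<phi> X Y \<longleftrightarrow>
     Y \<in> holder_space \<gamma> J \<and>
     (\<forall>t\<in>J. \<forall>i\<in>Basis.
        Y t \<bullet> i = y \<bullet> i + (\<Sum>j\<in>Basis.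
          young_integral \<gamma> \<gamma> J (\<lambda>u. blinfun_apply (\<phi> (Y u)) j \<bullet> i) (\<lambda>u. X u \<bullet> j) t0 t))"

definition young_flow ::
    "real \<Rightarrow> real set \<Rightarrow> real \<Rightarrow> 'v::euclidean_space \<Rightarrow> ('v \<Rightarrow> 'v \<Rightarrow>\<^sub>L 'v) \<Rightarrow> (real \<Rightarrow> 'v)
      \<Rightarrow> (real \<Rightarrow> 'v)" where
  "young_flow \<gamma> J t0 y \<phi> X = (THE Y. young_solution \<gamma> J t0 y \<phi> X Y)"

end

theory Submission imports Defs begin

text \<open>The equation is equivalent to a local one without integrals: a curve \<open>Y\<close> with \<open>Y t0 = y\<close> solves it iff
its increments follow the Euler scheme up to a superlinear error,
\<open>Y t - Y s - \<phi> (Y s) (X t - X s) = O(\<bar>t - s\<bar> powr (2 * \<gamma>))\<close>.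
Indeed the Young integral has such increments by definition of its remainder, and two curves whose increments
differ by \<open>O(\<bar>t - s\<bar> powr (2 * \<gamma>))\<close> with \<open>2 * \<gamma> > 1\<close> differ by a constant
(\<open>superlinear_increments_const\<close>, \<open>young_solution_iff_germ_solution\<close>). A curve with this property is
called a germ solution below.

All estimates rest on one principle. Let \<open>R s t\<close> be the error above, or the difference of two such errors. It is
not additive, but its defect \<open>R s t - R s u - R u t\<close> is explicit, and at most
\<open>(C + \<kappa> * M) * (t - s) powr \<rho>\<close> with \<open>\<rho> > 1\<close>, where \<open>M\<close> is a constant for which
\<open>R s t\<close> is at most \<open>M * (t - s) powr \<rho>\<close> and \<open>\<kappa>\<close> is as small as desired on short
intervals. Since two halves of an interval contribute only \<open>2 powr (1 - \<rho>) < 1\<close> times the bound for the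
whole, bisection replaces \<open>M\<close> by \<open>C + (\<kappa> + 2 powr (1 - \<rho>)) * M\<close>, and iteration leads to the
fixed point of this map, which no longer remembers \<open>M\<close>. The lemma \<open>defect_absorption\<close> is the version for
a continuous parameter, \<open>discrete_sewing_bound\<close> the one for Euler polygons, uniform in the partition.

Existence: the conditions that the germ estimate imposes on the pairs \<open>(s, t)\<close> are closed for pointwise
convergence, finitely many of them are satisfied by an Euler polygon, and the polygons take values in a fixed product
of balls. By Tychonoff's theorem they can all be satisfied at once (\<open>almost_flow_trajectory\<close>). This yields
solutions on short intervals, which are concatenated, and, for an Euler step that ignores the state, the Young
integral itself.

Stability, and with it uniqueness: apply the principle to the difference of the errors of two solutions. Its defect
contains a second difference of \<open>\<phi>\<close>, controlled by the Hoelder continuity of the derivative at the price of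
the exponent \<open>(1 + \<theta>) * \<gamma>\<close> in place of \<open>2 * \<gamma>\<close>; this is where
\<open>(1 + \<theta>) * \<gamma> > 1\<close> enters. On windows of a length \<open>h\<close> that depends only on a bound
\<open>B\<close> for the data, the distance of the two solutions at most doubles, up to the distance of the data
(\<open>local_stability\<close>, \<open>local_propagation\<close>). A number of windows depending on \<open>h\<close> and the
interval then leads from \<open>t0\<close> to any other time.\<close>

section \<open>Sewing bounds\<close>

lemma two_halves_powr:
  fixes x \<rho> :: real
  assumes "0 \<le> x"
  shows "2 * (x / 2) powr \<rho> = 2 powr (1 - \<rho>) * x powr \<rho>"
  using assms by (simp add: powr_divide powr_diff)

lemma two_powr_gap:
  fixes \<rho> :: real
  assumes "1 < \<rho>"
  shows "0 < 1 - 2 powr (1 - \<rho>)"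
proof -
  have "2 powr (1 - \<rho>) < 2 powr 0" using assms by (intro powr_less_mono) auto
  thus ?thesis by simp
qed

text \<open>If \<open>M\<close> bounds \<open>R\<close>, then bisecting \<open>[s, t]\<close> shows that
\<open>C + (\<kappa> + 2 powr (1 - \<rho>)) * M\<close> does so as well. The least admissible constant is therefore at most
the fixed point of this affine contraction. The bound \<open>N\<close> only guarantees that there is an admissible
constant; it has disappeared from the conclusion.\<close>

lemma defect_absorption:
  fixes R :: "real \<Rightarrow> real \<Rightarrow> 'v::real_normed_vector"
  assumes C: "0 \<le> C" and \<kappa>: "0 \<le> \<kappa>" and small: "2 powr (1 - \<rho>) + \<kappa> < 1"
    and finite_bound: "\<And>s t. p \<le> s \<Longrightarrow> s \<le> t \<Longrightarrow> t \<le> q \<Longrightarrow> norm (R s t) \<le> N * (t - s) powr \<rho>"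
    and defect: "\<And>M s u t. 0 \<le> M \<Longrightarrow>
        (\<And>s t. p \<le> s \<Longrightarrow> s \<le> t \<Longrightarrow> t \<le> q \<Longrightarrow> norm (R s t) \<le> M * (t - s) powr \<rho>) \<Longrightarrow>
        p \<le> s \<Longrightarrow> s \<le> u \<Longrightarrow> u \<le> t \<Longrightarrow> t \<le> q \<Longrightarrow>
        norm (R s t - R s u - R u t) \<le> (C + \<kappa> * M) * (t - s) powr \<rho>"
    and st: "p \<le> s" "s \<le> t" "t \<le> q"
  shows "norm (R s t) \<le> C / (1 - \<kappa> - 2 powr (1 - \<rho>)) * (t - s) powr \<rho>"
proof -
  define adm where "adm M \<longleftrightarrow> 0 \<le> M \<and>
    (\<forall>s t. p \<le> s \<longrightarrow> s \<le> t \<longrightarrow> t \<le> q \<longrightarrow> norm (R s t) \<le> M * (t - s) powr \<rho>)" for M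
  define m where "m = Inf {M. adm M}"
  have "adm (max 0 N)"
    unfolding adm_def
    by (auto intro!: order_trans[OF finite_bound] mult_right_mono)
  hence ne: "{M. adm M} \<noteq> {}" by blast
  have bdd: "bdd_below {M. adm M}" by (auto simp: adm_def bdd_below_def)
  have m0: "0 \<le> m"
    unfolding m_def by (rule cInf_greatest[OF ne]) (auto simp: adm_def)
  have "norm (R s t) \<le> m * (t - s) powr \<rho>" if "p \<le> s" "s \<le> t" "t \<le> q" for s t
  proof (cases "s = t")
    case True
    then show ?thesis using finite_bound[of s t] that by simp
  next
    case False
    hence pos: "0 < (t - s) powr \<rho>" using that by simp
    have "norm (R s t) / (t - s) powr \<rho> \<le> m"
      unfolding m_def
    proof (rule cInf_greatest[OF ne])
      fix M assume "M \<in> {M. adm M}"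
      hence "norm (R s t) \<le> M * (t - s) powr \<rho>" using that by (auto simp: adm_def)
      thus "norm (R s t) / (t - s) powr \<rho> \<le> M" using pos by (simp add: pos_divide_le_eq)
    qed
    thus ?thesis using pos by (simp add: pos_divide_le_eq)
  qed
  hence m: "p \<le> s \<Longrightarrow> s \<le> t \<Longrightarrow> t \<le> q \<Longrightarrow> norm (R s t) \<le> m * (t - s) powr \<rho>" for s t by blast
  define m' where "m' = C + (\<kappa> + 2 powr (1 - \<rho>)) * m"
  \<comment> \<open>One bisection: the new constant \<open>m'\<close> is admissible, hence at least the infimum \<open>m\<close>.\<close>
  have "adm m'"
    unfolding adm_def
  proof (intro conjI allI impI)
    show "0 \<le> m'" unfolding m'_def using C \<kappa> m0 by simp
    fix s t assume st: "p \<le> s" "s \<le> t" "t \<le> q"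
    define u where "u = (s + t) / 2"
    have u: "s \<le> u" "u \<le> t" and half: "u - s = (t - s) / 2" "t - u = (t - s) / 2"
      using st by (auto simp: u_def field_simps)
    have "norm (R s u) \<le> m * ((t - s) / 2) powr \<rho>" "norm (R u t) \<le> m * ((t - s) / 2) powr \<rho>"
      using m[of s u] m[of u t] st u half by auto
    moreover have "norm (R s t - R s u - R u t) \<le> (C + \<kappa> * m) * (t - s) powr \<rho>"
      using defect[OF m0 m] st u by blast
    moreover have "norm (R s t) \<le> norm (R s t - R s u - R u t) + norm (R s u) + norm (R u t)"
      using norm_triangle_ineq[of "R s t - R s u - R u t" "R s u + R u t"]
        norm_triangle_ineq[of "R s u" "R u t"] by simp
    moreover have "m * ((t - s) / 2) powr \<rho> + m * ((t - s) / 2) powr \<rho>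
        = m * (2 powr (1 - \<rho>) * (t - s) powr \<rho>)"
      unfolding two_halves_powr[of "t - s" \<rho>, symmetric, OF diff_ge_0_iff_ge[THEN iffD2, OF st(2)]]
      by (simp add: algebra_simps)
    moreover have "m' * (t - s) powr \<rho>
        = (C + \<kappa> * m) * (t - s) powr \<rho> + m * (2 powr (1 - \<rho>) * (t - s) powr \<rho>)"
      by (simp add: m'_def algebra_simps)
    ultimately show "norm (R s t) \<le> m' * (t - s) powr \<rho>" by linarith
  qed
  hence "m \<le> m'" unfolding m_def using bdd by (simp add: cInf_lower)
  hence "m * (1 - \<kappa> - 2 powr (1 - \<rho>)) \<le> C" by (simp add: m'_def algebra_simps)
  hence "m \<le> C / (1 - \<kappa> - 2 powr (1 - \<rho>))" using small by (simp add: pos_le_divide_eq)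
  thus ?thesis using m[OF st] by (meson mult_right_mono order_trans powr_ge_zero)
qed

text \<open>The same bisection for a finite sequence of times: split the index interval at the last time \<open>\<tau> m\<close>
before the midpoint. The two parts \<open>[i, m]\<close> and \<open>[Suc m, j]\<close> are at most half as long, and
the step from \<open>m\<close> to \<open>Suc m\<close> in between, of whatever length, carries no error. The bound is thus
independent of the partition.\<close>

lemma discrete_sewing_bound:
  fixes R :: "nat \<Rightarrow> nat \<Rightarrow> 'v::real_normed_vector" and \<tau> :: "nat \<Rightarrow> real"
  assumes C: "0 \<le> C" and \<kappa>: "0 \<le> \<kappa>" and \<rho>: "0 \<le> \<rho>" and small: "2 powr (1 - \<rho>) + 2 * \<kappa> < 1"
    and mono: "\<And>i j. i \<le> j \<Longrightarrow> j \<le> N \<Longrightarrow> \<tau> i \<le> \<tau> j"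
    and null: "\<And>i. R i i = 0" and step: "\<And>i. i < N \<Longrightarrow> R i (Suc i) = 0"
    and defect: "\<And>i k j. i \<le> k \<Longrightarrow> k \<le> j \<Longrightarrow> j \<le> N \<Longrightarrow>
        norm (R i j - R i k - R k j) \<le> C * (\<tau> j - \<tau> i) powr \<rho> + \<kappa> * norm (R i k)"
    and ij: "i \<le> j" "j \<le> N"
  shows "norm (R i j) \<le> 2 * C / (1 - 2 * \<kappa> - 2 powr (1 - \<rho>)) * (\<tau> j - \<tau> i) powr \<rho>"
  using ij
proof (induction "j - i" arbitrary: i j rule: less_induct)
  case (less i j)
  define K where "K = 2 * C / (1 - 2 * \<kappa> - 2 powr (1 - \<rho>))"
  have K0: "0 \<le> K" unfolding K_def using C small by simp
  have Keq: "K * (1 - 2 * \<kappa> - 2 powr (1 - \<rho>)) = 2 * C" unfolding K_def using small by simp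
  show ?case
  proof (cases "j \<le> Suc i")
    case True
    hence "j = i \<or> j = Suc i" using less.prems by linarith
    hence "R i j = 0" using null[of i] step[of i] less.prems by auto
    thus ?thesis using K0 by (metis K_def mult_nonneg_nonneg norm_zero powr_ge_zero)
  next
    case False
    define T where "T = \<tau> j - \<tau> i"
    have T0: "0 \<le> T" using mono less.prems by (simp add: T_def)
    define P where "P k \<longleftrightarrow> i \<le> k \<and> k < j \<and> \<tau> k - \<tau> i \<le> T / 2" for k
    define m where "m = Greatest P"
    have "P i" using T0 False by (simp add: P_def)
    hence Pm: "P m" unfolding m_def by (rule GreatestI_nat[where b = j]) (auto simp: P_def)
    have m: "i \<le> m" "m < j" and left: "\<tau> m - \<tau> i \<le> T / 2" using Pm by (auto simp: P_def)
    have right: "\<tau> j - \<tau> (Suc m) \<le> T / 2"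
    proof (cases "Suc m = j")
      case True then show ?thesis using T0 by simp
    next
      case False
      have "\<not> P (Suc m)"
        using Greatest_le_nat[of P "Suc m" j] by (auto simp: P_def m_def[symmetric])
      thus ?thesis using m False by (auto simp: P_def T_def field_simps)
    qed
    have mono_K: "K * x powr \<rho> \<le> K * (T / 2) powr \<rho>" if "0 \<le> x" "x \<le> T / 2" for x
      using that \<rho> K0 by (intro mult_left_mono powr_mono2) auto
    note IH = less.hyps[folded K_def]
    have Rl: "norm (R i m) \<le> K * (T / 2) powr \<rho>"
      using IH[of m i] m less.prems mono_K[OF _ left] mono[of i m] by fastforce
    have Rr: "norm (R (Suc m) j) \<le> K * (T / 2) powr \<rho>"
      using IH[of j "Suc m"] m less.prems mono_K[OF _ right] mono[of "Suc m" j] by fastforce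
    have sm: "norm (R m j - R m (Suc m) - R (Suc m) j) \<le> C * (\<tau> j - \<tau> m) powr \<rho>"
      using defect[of m "Suc m" j] step[of m] m less.prems by simp
    have "(\<tau> j - \<tau> m) powr \<rho> \<le> T powr \<rho>"
      using mono[of i m] mono[of m j] m less.prems \<rho> by (intro powr_mono2) (auto simp: T_def)
    hence sm': "norm (R m j - R m (Suc m) - R (Suc m) j) \<le> C * T powr \<rho>"
      using sm C by (meson mult_left_mono order_trans)
    have d: "norm (R i j - R i m - R m j) \<le> C * T powr \<rho> + \<kappa> * norm (R i m)"
      using defect[of i m j] m less.prems by (simp add: T_def)
    have "(T / 2) powr \<rho> \<le> T powr \<rho>" using T0 \<rho> by (intro powr_mono2) auto
    hence "\<kappa> * norm (R i m) \<le> \<kappa> * (K * T powr \<rho>)"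
      using Rl K0 \<kappa> by (intro mult_left_mono) (auto intro: order_trans mult_left_mono)
    moreover have "norm (R i j) \<le> norm (R i j - R i m - R m j) + norm (R i m)
        + norm (R m j - R m (Suc m) - R (Suc m) j) + norm (R (Suc m) j)"
    proof -
      have "R i j = (R i j - R i m - R m j) + R i m + (R m j - R m (Suc m) - R (Suc m) j) + R (Suc m) j"
        using step[of m] m less.prems by simp
      thus ?thesis
        using norm_triangle_le[OF add_right_mono[OF norm_triangle_le[OF add_right_mono[OF norm_triangle_ineq]]]]
        by (metis)
    qed
    ultimately have "norm (R i j) \<le> 2 * C * T powr \<rho> + \<kappa> * (K * T powr \<rho>) + K * (2 * (T / 2) powr \<rho>)"
      using Rl Rr sm' d by linarith
    also have "\<dots> = (2 * C + \<kappa> * K + K * 2 powr (1 - \<rho>)) * T powr \<rho>"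
      by (simp add: two_halves_powr[OF T0] algebra_simps)
    also have "\<dots> \<le> K * T powr \<rho>"
    proof (rule mult_right_mono)
      have "0 \<le> \<kappa> * K" using \<kappa> K0 by simp
      thus "2 * C + \<kappa> * K + K * 2 powr (1 - \<rho>) \<le> K" using Keq by (simp add: algebra_simps)
    qed simp
    finally show ?thesis by (simp add: K_def T_def)
  qed
qed

section \<open>Trajectories of almost flows\<close>

text \<open>\<open>A s t y\<close> is an approximate displacement over \<open>[s, t]\<close> of a point that is at \<open>y\<close>
at time \<open>s\<close>. The defect hypothesis compares the displacement over \<open>[s, t]\<close> with a composition of
two, where the second starts at a point \<open>z\<close> that the first one may miss. The curve below follows \<open>A\<close>
exactly from each point of \<open>P\<close> to the next.\<close>

lemma euler_polygon:
  fixes A :: "real \<Rightarrow> real \<Rightarrow> 'v \<Rightarrow> 'v::real_normed_vector"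
  assumes C: "0 \<le> C" and \<kappa>: "0 \<le> \<kappa>" and \<rho>: "0 \<le> \<rho>" and small: "2 powr (1 - \<rho>) + 2 * \<kappa> < 1"
    and null: "\<And>s y. A s s y = 0"
    and defect: "\<And>s u t y z. a \<le> s \<Longrightarrow> s \<le> u \<Longrightarrow> u \<le> t \<Longrightarrow> t \<le> b \<Longrightarrow>
        norm (A u t z + A s u y - A s t y) \<le> C * (t - s) powr \<rho> + \<kappa> * norm (z - y - A s u y)"
    and P: "finite P" "P \<subseteq> {a..b}" "a \<in> P"
  obtains Y where "Y a = y0"
    "\<And>s t. s \<in> P \<Longrightarrow> t \<in> P \<Longrightarrow> s \<le> t \<Longrightarrow>
      norm (Y t - Y s - A s t (Y s)) \<le> 2 * C / (1 - 2 * \<kappa> - 2 powr (1 - \<rho>)) * (t - s) powr \<rho>"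
proof -
  define xs where "xs = sorted_list_of_set P"
  define \<tau> where "\<tau> k = xs ! k" for k
  define N where "N = length xs - 1"
  have xs: "set xs = P" "sorted_wrt (<) xs" "xs \<noteq> []" using P
    by (auto simp: xs_def strict_sorted_list_of_set)
  have mono: "\<tau> i \<le> \<tau> j" if "i \<le> j" "j \<le> N" for i j
    using that xs by (auto simp: \<tau>_def N_def intro!: sorted_nth_mono strict_sorted_imp_sorted)
      (metis One_nat_def Suc_pred length_greater_0_conv less_Suc_eq_le)
  have dist: "distinct xs" using xs(2) strict_sorted_iff by blast
  have idx: "\<exists>k\<le>N. \<tau> k = t" if "t \<in> P" for t
    using that xs by (metis N_def One_nat_def Suc_pred \<tau>_def in_set_conv_nth length_greater_0_conv less_Suc_eq_le)
  have inj: "i = j" if "\<tau> i = \<tau> j" "i \<le> N" "j \<le> N" for i j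
    using that xs(3) dist unfolding \<tau>_def N_def
    by (metis One_nat_def Suc_pred length_greater_0_conv less_Suc_eq_le nth_eq_iff_index_eq)
  have in_P: "\<tau> i \<in> P" if "i \<le> N" for i
    using that xs unfolding \<tau>_def N_def
    by (metis One_nat_def Suc_pred length_greater_0_conv less_Suc_eq_le nth_mem)
  have \<tau>0: "\<tau> 0 = a"
  proof -
    obtain k where k: "k \<le> N" "\<tau> k = a" using idx[OF P(3)] by blast
    have "\<tau> 0 \<le> a" using mono[of 0 k] k by simp
    moreover have "a \<le> \<tau> 0" using in_P[of 0] P(2) by auto
    ultimately show ?thesis by simp
  qed
  define y where "y = rec_nat y0 (\<lambda>k z. z + A (\<tau> k) (\<tau> (Suc k)) z)"
  have y: "y 0 = y0" "y (Suc k) = y k + A (\<tau> k) (\<tau> (Suc k)) (y k)" for k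
    by (simp_all add: y_def)
  define R where "R i j = y j - y i - A (\<tau> i) (\<tau> j) (y i)" for i j
  have bound: "norm (R i j) \<le> 2 * C / (1 - 2 * \<kappa> - 2 powr (1 - \<rho>)) * (\<tau> j - \<tau> i) powr \<rho>"
    if "i \<le> j" "j \<le> N" for i j
  proof (rule discrete_sewing_bound[OF C \<kappa> \<rho> small mono])
    show "R i i = 0" for i by (simp add: R_def null)
    show "R i (Suc i) = 0" for i by (simp add: R_def y)
    fix i k j assume ikj: "i \<le> k" "k \<le> j" "j \<le> N"
    have "\<tau> i \<in> {a..b}" "\<tau> j \<in> {a..b}" using in_P[of i] in_P[of j] P(2) ikj by auto
    hence "norm (A (\<tau> k) (\<tau> j) (y k) + A (\<tau> i) (\<tau> k) (y i) - A (\<tau> i) (\<tau> j) (y i))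
        \<le> C * (\<tau> j - \<tau> i) powr \<rho> + \<kappa> * norm (R i k)"
      using defect[of "\<tau> i" "\<tau> k" "\<tau> j" "y k" "y i"] mono[of i k] mono[of k j] ikj
      by (simp only: R_def) simp
    moreover have "R i j - R i k - R k j
        = A (\<tau> k) (\<tau> j) (y k) + A (\<tau> i) (\<tau> k) (y i) - A (\<tau> i) (\<tau> j) (y i)"
      by (simp add: R_def)
    ultimately show "norm (R i j - R i k - R k j) \<le> C * (\<tau> j - \<tau> i) powr \<rho> + \<kappa> * norm (R i k)"
      by (simp only:)
  qed (use that in auto)
  define Y where "Y t = y (THE k. k \<le> N \<and> \<tau> k = t)" for t
  have Y: "Y (\<tau> k) = y k" if "k \<le> N" for k
    unfolding Y_def using that inj by (metis (mono_tags, lifting) the_equality)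
  show thesis
  proof
    show "Y a = y0" using Y[of 0] \<tau>0 y by simp
    fix s t assume st: "s \<in> P" "t \<in> P" "s \<le> t"
    obtain i where i: "i \<le> N" "\<tau> i = s" using idx st by blast
    obtain j where j: "j \<le> N" "\<tau> j = t" using idx st by blast
    have "i \<le> j"
    proof (rule ccontr)
      assume "\<not> i \<le> j"
      hence "s = t" using mono[of j i] i j st by simp
      thus False using inj[of i j] i j \<open>\<not> i \<le> j\<close> by simp
    qed
    thus "norm (Y t - Y s - A s t (Y s)) \<le> 2 * C / (1 - 2 * \<kappa> - 2 powr (1 - \<rho>)) * (t - s) powr \<rho>"
      using bound[of i j] i j Y[of i] Y[of j] by (simp add: R_def)
  qed
qed

text \<open>Tychonoff's theorem in place of a limit of Euler polygons: each pair \<open>(s, t)\<close> imposes a condition that is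
closed in the product topology, and finitely many of them concern finitely many times, for which
\<open>euler_polygon\<close> provides a curve. The case \<open>s = a\<close> of the estimate confines the values at each time
to a fixed ball, which makes the product compact.\<close>

lemma almost_flow_trajectory:
  fixes A :: "real \<Rightarrow> real \<Rightarrow> 'v \<Rightarrow> 'v::euclidean_space"
  assumes C: "0 \<le> C" and \<kappa>: "0 \<le> \<kappa>" and \<rho>: "0 \<le> \<rho>" and small: "2 powr (1 - \<rho>) + 2 * \<kappa> < 1"
    and null: "\<And>s y. A s s y = 0"
    and cont: "\<And>s t. continuous_on UNIV (A s t)"
    and defect: "\<And>s u t y z. a \<le> s \<Longrightarrow> s \<le> u \<Longrightarrow> u \<le> t \<Longrightarrow> t \<le> b \<Longrightarrow>
        norm (A u t z + A s u y - A s t y) \<le> C * (t - s) powr \<rho> + \<kappa> * norm (z - y - A s u y)"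
    and ab: "a \<le> b"
  obtains Y K where "Y a = y0"
    "\<And>s t. a \<le> s \<Longrightarrow> s \<le> t \<Longrightarrow> t \<le> b \<Longrightarrow> norm (Y t - Y s - A s t (Y s)) \<le> K * (t - s) powr \<rho>"
proof -
  define K where "K = 2 * C / (1 - 2 * \<kappa> - 2 powr (1 - \<rho>))"
  define Q where "Q = {(s, t). a \<le> s \<and> s \<le> t \<and> t \<le> b}"
  define F where "F = (\<lambda>(s, t). {Y. norm (Y t - Y s - A s t (Y s)) \<le> K * (t - s) powr \<rho>})"
  define box where "box = PiE UNIV (\<lambda>t. cball (y0 + A a t y0) (K * (t - a) powr \<rho>))"
  have "compactin (product_topology (\<lambda>_::real. euclidean) UNIV) box"
    unfolding box_def by (subst compactin_PiE) auto
  hence compact_box: "compact box" by (simp add: euclidean_product_topology)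
  have closed_F: "closed (F c)" for c
  proof -
    obtain s t where c: "c = (s, t)" by fastforce
    have "continuous_on UNIV (\<lambda>Y. A s t (Y s))"
      by (rule continuous_on_compose2[OF cont continuous_on_product_coordinates]) simp
    thus ?thesis unfolding F_def c prod.case
      by (intro closed_Collect_le continuous_intros continuous_on_product_coordinates)
  qed
  have "box \<inter> \<Inter> (F ` Q) \<noteq> {}"
  proof (rule compact_imp_fip[OF compact_box])
    show "closed T" if "T \<in> F ` Q" for T using that closed_F by auto
    fix \<F> assume "finite \<F>" "\<F> \<subseteq> F ` Q"
    then obtain Q' where Q': "Q' \<subseteq> Q" "finite Q'" "\<F> = F ` Q'"
      by (meson finite_subset_image)
    define P where "P = insert a (fst ` Q' \<union> snd ` Q')"
    have P: "finite P" "P \<subseteq> {a..b}" "a \<in> P"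
      using Q' ab by (auto simp: P_def Q_def)
    obtain Y where Y: "Y a = y0"
      "\<And>s t. s \<in> P \<Longrightarrow> t \<in> P \<Longrightarrow> s \<le> t \<Longrightarrow> norm (Y t - Y s - A s t (Y s)) \<le> K * (t - s) powr \<rho>"
      unfolding K_def
      using euler_polygon[where A = A, OF C \<kappa> \<rho> small null defect P] by blast
    have K0: "0 \<le> K" using C small by (simp add: K_def)
    \<comment> \<open>Outside \<open>P\<close> the curve is put at the centres of the balls, to keep it in the box.\<close>
    define Y' where "Y' t = (if t \<in> P then Y t else y0 + A a t y0)" for t
    have "Y' t \<in> cball (y0 + A a t y0) (K * (t - a) powr \<rho>)" for t
    proof (cases "t \<in> P")
      case True
      moreover have "dist (y0 + A a t y0) (Y t) = norm (Y t - y0 - A a t y0)"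
        unfolding dist_norm by (simp add: norm_minus_commute diff_diff_eq)
      moreover have "a \<le> t" using True P by auto
      ultimately show ?thesis using Y(2)[of a t] Y(1) P by (simp add: Y'_def)
    next
      case False
      then show ?thesis using K0 by (simp add: Y'_def)
    qed
    hence "Y' \<in> box" by (auto simp: box_def)
    moreover have "Y' \<in> F c" if "c \<in> Q'" for c
    proof -
      obtain s t where c: "c = (s, t)" by fastforce
      have "s \<in> P" "t \<in> P" using imageI[OF that, of fst] imageI[OF that, of snd] by (simp_all add: P_def c)
      moreover have "s \<le> t" using that Q'(1) by (auto simp: c Q_def)
      ultimately show ?thesis using Y(2) by (simp add: F_def c Y'_def)
    qed
    ultimately show "box \<inter> \<Inter> \<F> \<noteq> {}" using Q' by blast
  qed
  then obtain Y where Y: "Y \<in> box" "\<And>c. c \<in> Q \<Longrightarrow> Y \<in> F c" by blast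
  show thesis
  proof
    have "Y a \<in> cball (y0 + A a a y0) (K * (a - a) powr \<rho>)" using Y(1) unfolding box_def by (rule PiE_mem) simp
    thus "Y a = y0" by (simp add: null)
    show "norm (Y t - Y s - A s t (Y s)) \<le> K * (t - s) powr \<rho>" if "a \<le> s" "s \<le> t" "t \<le> b" for s t
      using Y(2)[of "(s, t)"] that by (simp add: Q_def F_def)
  qed
qed

section \<open>Existence of germ solutions\<close>

definition increments_le ::
    "real \<Rightarrow> real \<Rightarrow> real \<Rightarrow> real \<Rightarrow> (real \<Rightarrow> 'u::real_normed_vector) \<Rightarrow> bool" where
  "increments_le \<gamma> B a b X \<longleftrightarrow>
     (\<forall>s t. a \<le> s \<longrightarrow> s \<le> t \<longrightarrow> t \<le> b \<longrightarrow> norm (X t - X s) \<le> B * (t - s) powr \<gamma>)"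

definition euler_remainder ::
    "('v \<Rightarrow> 'u \<Rightarrow>\<^sub>L 'v) \<Rightarrow> (real \<Rightarrow> 'u::real_normed_vector) \<Rightarrow> (real \<Rightarrow> 'v::real_normed_vector)
      \<Rightarrow> real \<Rightarrow> real \<Rightarrow> 'v" where
  "euler_remainder \<phi> X Y s t = Y t - Y s - blinfun_apply (\<phi> (Y s)) (X t - X s)"

definition germ_solution ::
    "real \<Rightarrow> ('v \<Rightarrow> 'u \<Rightarrow>\<^sub>L 'v) \<Rightarrow> (real \<Rightarrow> 'u::real_normed_vector) \<Rightarrow> real \<Rightarrow> real \<Rightarrow> real
      \<Rightarrow> (real \<Rightarrow> 'v::real_normed_vector) \<Rightarrow> bool" where
  "germ_solution \<gamma> \<phi> X K a b Y \<longleftrightarrow>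
     (\<forall>s t. a \<le> s \<longrightarrow> s \<le> t \<longrightarrow> t \<le> b \<longrightarrow>
        norm (euler_remainder \<phi> X Y s t) \<le> K * (t - s) powr (2 * \<gamma>))"

definition lipschitz_bounded ::
    "real \<Rightarrow> ('v::real_normed_vector \<Rightarrow> 'w::real_normed_vector) \<Rightarrow> bool" where
  "lipschitz_bounded B \<phi> \<longleftrightarrow> (\<forall>x. norm (\<phi> x) \<le> B) \<and> (\<forall>x z. norm (\<phi> x - \<phi> z) \<le> B * norm (x - z))"

lemma increments_leD:
  "increments_le \<gamma> B a b X \<Longrightarrow> a \<le> s \<Longrightarrow> s \<le> t \<Longrightarrow> t \<le> b \<Longrightarrow> norm (X t - X s) \<le> B * (t - s) powr \<gamma>"
  by (auto simp: increments_le_def)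

lemma increments_le_subinterval:
  "increments_le \<gamma> B a b X \<Longrightarrow> a \<le> a' \<Longrightarrow> b' \<le> b \<Longrightarrow> increments_le \<gamma> B a' b' X"
  by (auto simp: increments_le_def)

lemma germ_solutionD:
  "germ_solution \<gamma> \<phi> X K a b Y \<Longrightarrow> a \<le> s \<Longrightarrow> s \<le> t \<Longrightarrow> t \<le> b \<Longrightarrow>
    norm (euler_remainder \<phi> X Y s t) \<le> K * (t - s) powr (2 * \<gamma>)"
  by (auto simp: germ_solution_def)

lemma germ_solution_subinterval:
  "germ_solution \<gamma> \<phi> X K a b Y \<Longrightarrow> a \<le> a' \<Longrightarrow> b' \<le> b \<Longrightarrow> germ_solution \<gamma> \<phi> X K a' b' Y"
  by (auto simp: germ_solution_def)

lemma lipschitz_boundedD: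
  assumes "lipschitz_bounded B \<phi>"
  shows "norm (\<phi> x) \<le> B" "norm (\<phi> x - \<phi> z) \<le> B * norm (x - z)" "0 \<le> B"
proof -
  show "norm (\<phi> x) \<le> B" "norm (\<phi> x - \<phi> z) \<le> B * norm (x - z)"
    using assms by (simp_all add: lipschitz_bounded_def)
  from order_trans[OF norm_ge_zero this(1)] show "0 \<le> B" .
qed

text \<open>The identity behind all estimates: the increments of \<open>Y\<close> and \<open>X\<close> are additive, so only the
variation of the coefficient contributes.\<close>

lemma euler_remainder_defect:
  "euler_remainder \<phi> X Y s t - euler_remainder \<phi> X Y s u - euler_remainder \<phi> X Y u t
    = blinfun_apply (\<phi> (Y u) - \<phi> (Y s)) (X t - X u)"
  by (simp add: euler_remainder_def blinfun.bilinear_simps algebra_simps)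

lemma powr_split_le:
  fixes s u t :: real
  assumes "s \<le> u" "u \<le> t" "0 \<le> \<alpha>" "0 \<le> \<beta>"
  shows "(u - s) powr \<alpha> * (t - u) powr \<beta> \<le> (t - s) powr (\<alpha> + \<beta>)"
  unfolding powr_add using assms by (intro mult_mono powr_mono2) auto

lemma blinfun_apply_le:
  assumes "norm f \<le> c" "norm x \<le> d"
  shows "norm (blinfun_apply f x) \<le> c * d"
  using norm_blinfun[of f x] assms by (meson mult_mono norm_ge_zero order_trans)

lemma blinfun_apply_increment_le:
  assumes "norm f \<le> c" "increments_le \<gamma> B a b X" "a \<le> s" "s \<le> t" "t \<le> b"
  shows "norm (blinfun_apply f (X t - X s)) \<le> c * (B * (t - s) powr \<gamma>)"
  by (rule blinfun_apply_le[OF assms(1) increments_leD[OF assms(2-5)]])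

lemma lipschitz_defect_le:
  assumes \<gamma>: "0 \<le> \<gamma>" and \<phi>: "lipschitz_bounded B \<phi>"
    and z: "norm (z' - z) \<le> L * v powr \<gamma>" and x: "norm x \<le> B * w powr \<gamma>"
    and r: "0 \<le> v" "v \<le> r" "0 \<le> w" "w \<le> r" and L: "0 \<le> L"
  shows "norm (blinfun_apply (\<phi> z' - \<phi> z) x) \<le> B\<^sup>2 * L * r powr (2 * \<gamma>)"
proof -
  note B = lipschitz_boundedD[OF \<phi>]
  have "norm (\<phi> z' - \<phi> z) \<le> B * (L * v powr \<gamma>)"
    by (rule order_trans[OF B(2) mult_left_mono[OF z B(3)]])
  hence "norm (blinfun_apply (\<phi> z' - \<phi> z) x) \<le> B * (L * v powr \<gamma>) * (B * w powr \<gamma>)"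
    by (rule blinfun_apply_le[OF _ x])
  also have "\<dots> = B\<^sup>2 * L * (v powr \<gamma> * w powr \<gamma>)"
    by (simp add: algebra_simps power2_eq_square)
  also have "\<dots> \<le> B\<^sup>2 * L * (r powr \<gamma> * r powr \<gamma>)"
    using r \<gamma> L by (intro mult_left_mono mult_mono powr_mono2) auto
  finally show ?thesis by (simp flip: powr_add)
qed

text \<open>On a short interval the Euler step \<open>\<phi> y (X t - X s)\<close> is an almost flow: an error in the starting point is
multiplied by the Lipschitz constant of \<open>\<phi>\<close> and an increment of \<open>X\<close>, hence by at most
\<open>B\<^sup>2 * h powr \<gamma>\<close>.\<close>

lemma local_germ_solution:
  fixes X :: "real \<Rightarrow> 'u::real_normed_vector" and \<phi> :: "'v::euclidean_space \<Rightarrow> 'u \<Rightarrow>\<^sub>L 'v"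
  assumes \<gamma>: "0 \<le> \<gamma>" and X: "increments_le \<gamma> B a b X" and \<phi>: "lipschitz_bounded B \<phi>"
    and h: "b - a \<le> h" and small: "2 powr (1 - 2 * \<gamma>) + 2 * (B\<^sup>2 * h powr \<gamma>) < 1" and ab: "a \<le> b"
  obtains Y K where "Y a = y0" "0 \<le> K" "germ_solution \<gamma> \<phi> X K a b Y"
proof -
  define A where "A s t y = blinfun_apply (\<phi> y) (X t - X s)" for s t y
  note B = lipschitz_boundedD[OF \<phi>]
  have cont_\<phi>: "continuous_on UNIV \<phi>"
    by (rule lipschitz_on_continuous_on[of B]) (use B in \<open>auto simp: lipschitz_on_def dist_norm\<close>)
  have cont: "continuous_on UNIV (A s t)" for s t
    unfolding A_def by (intro continuous_intros cont_\<phi>)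
  have defect: "norm (A u t z + A s u y - A s t y)
      \<le> B ^ 4 * (t - s) powr (2 * \<gamma>) + B\<^sup>2 * h powr \<gamma> * norm (z - y - A s u y)"
    if st: "a \<le> s" "s \<le> u" "u \<le> t" "t \<le> b" for s u t y z
  proof -
    have "A u t z + A s u y - A s t y = blinfun_apply (\<phi> z - \<phi> y) (X t - X u)"
      by (simp add: A_def blinfun.bilinear_simps algebra_simps)
    hence "norm (A u t z + A s u y - A s t y) \<le> (B * norm (z - y)) * (B * (t - u) powr \<gamma>)"
      using blinfun_apply_increment_le[OF B(2) X, of u t z y] st by simp
    also have "norm (z - y) \<le> norm (z - y - A s u y) + B * (B * (u - s) powr \<gamma>)"
    proof -
      have "norm (A s u y) \<le> B * (B * (u - s) powr \<gamma>)"
        unfolding A_def using blinfun_apply_increment_le[OF B(1) X, of s u y] st by simp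
      thus ?thesis using norm_triangle_ineq[of "z - y - A s u y" "A s u y"] by simp
    qed
    also have "(B * (norm (z - y - A s u y) + B * (B * (u - s) powr \<gamma>))) * (B * (t - u) powr \<gamma>)
        = B ^ 4 * ((u - s) powr \<gamma> * (t - u) powr \<gamma>) + B\<^sup>2 * (t - u) powr \<gamma> * norm (z - y - A s u y)"
      by (simp add: algebra_simps power2_eq_square power4_eq_xxxx)
    also have "\<dots> \<le> B ^ 4 * (t - s) powr (2 * \<gamma>) + B\<^sup>2 * h powr \<gamma> * norm (z - y - A s u y)"
      using powr_split_le[of s u t \<gamma> \<gamma>] st \<gamma> h B(3)
      by (intro add_mono mult_left_mono mult_right_mono powr_mono2) auto
    finally show ?thesis using B(3) by (simp add: mult_left_mono mult_right_mono)
  qed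
  obtain Y K where Y: "Y a = y0"
    "\<And>s t. a \<le> s \<Longrightarrow> s \<le> t \<Longrightarrow> t \<le> b \<Longrightarrow> norm (Y t - Y s - A s t (Y s)) \<le> K * (t - s) powr (2 * \<gamma>)"
  proof (rule almost_flow_trajectory[where A = A and C = "B ^ 4" and \<kappa> = "B\<^sup>2 * h powr \<gamma>"
        and \<rho> = "2 * \<gamma>" and a = a and b = b and ?y0.0 = y0])
    show "A s s y = 0" for s y by (simp add: A_def blinfun.bilinear_simps)
  qed (use B(3) \<gamma> small cont defect ab in auto)
  have "germ_solution \<gamma> \<phi> X (max 0 K) a b Y"
    unfolding germ_solution_def euler_remainder_def
    using Y(2) by (auto simp: A_def intro!: order_trans[OF Y(2)[unfolded A_def]] mult_right_mono)
  with Y(1) show thesis by (intro that[of Y "max 0 K"]) auto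
qed

lemma germ_solution_increments:
  assumes \<gamma>: "0 \<le> \<gamma>" and X: "increments_le \<gamma> B a b X" and \<phi>: "lipschitz_bounded B \<phi>"
    and Y: "germ_solution \<gamma> \<phi> X K a b Y" and K: "0 \<le> K"
  shows "increments_le \<gamma> (B\<^sup>2 + K * (b - a) powr \<gamma>) a b Y"
  unfolding increments_le_def
proof (intro allI impI)
  fix s t assume st: "a \<le> s" "s \<le> t" "t \<le> b"
  note B = lipschitz_boundedD[OF \<phi>]
  have "norm (blinfun_apply (\<phi> (Y s)) (X t - X s)) \<le> B * (B * (t - s) powr \<gamma>)"
    by (rule blinfun_apply_increment_le[OF B(1) X st])
  moreover have "norm (euler_remainder \<phi> X Y s t) \<le> K * (t - s) powr (2 * \<gamma>)"
    using germ_solutionD[OF Y] st by simp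
  moreover have "Y t - Y s = blinfun_apply (\<phi> (Y s)) (X t - X s) + euler_remainder \<phi> X Y s t"
    by (simp add: euler_remainder_def)
  ultimately have "norm (Y t - Y s) \<le> B * (B * (t - s) powr \<gamma>) + K * (t - s) powr (2 * \<gamma>)"
    by (simp only: norm_triangle_mono)
  also have "(t - s) powr (2 * \<gamma>) = (t - s) powr \<gamma> * (t - s) powr \<gamma>"
    by (simp flip: powr_add)
  also have "K * ((t - s) powr \<gamma> * (t - s) powr \<gamma>) \<le> K * ((b - a) powr \<gamma> * (t - s) powr \<gamma>)"
    using st \<gamma> K by (intro mult_left_mono mult_right_mono powr_mono2) auto
  finally show "norm (Y t - Y s) \<le> (B\<^sup>2 + K * (b - a) powr \<gamma>) * (t - s) powr \<gamma>"
    by (simp add: algebra_simps power2_eq_square)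
qed

text \<open>For a pair of times on different sides of \<open>c\<close> the remainder is the sum of those on both sides and of a
defect, and the defect is of the right order because \<open>\<phi>\<close> is Lipschitz.\<close>

lemma germ_solution_concat:
  assumes \<gamma>: "0 \<le> \<gamma>" and X: "increments_le \<gamma> B a b X" and \<phi>: "lipschitz_bounded B \<phi>"
    and Y1: "germ_solution \<gamma> \<phi> X K1 a c Y1" and Y2: "germ_solution \<gamma> \<phi> X K2 c b Y2"
    and K: "0 \<le> K1" "0 \<le> K2" and c: "a \<le> c" "c \<le> b" and match: "Y1 c = Y2 c"
  obtains K where "0 \<le> K" "germ_solution \<gamma> \<phi> X K a b (\<lambda>t. if t \<le> c then Y1 t else Y2 t)"
proof -
  define Y where "Y t = (if t \<le> c then Y1 t else Y2 t)" for t
  define L where "L = B\<^sup>2 + K1 * (c - a) powr \<gamma>"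
  define K where "K = K1 + K2 + B\<^sup>2 * L"
  have L0: "0 \<le> L" using K by (simp add: L_def)
  have Yc: "Y t = Y2 t" if "c \<le> t" for t using that match by (auto simp: Y_def)
  have left: "norm (euler_remainder \<phi> X Y s t) \<le> K1 * (t - s) powr (2 * \<gamma>)"
    if "a \<le> s" "s \<le> t" "t \<le> c" for s t
    using germ_solutionD[OF Y1 that] that by (simp add: euler_remainder_def Y_def)
  have right: "norm (euler_remainder \<phi> X Y s t) \<le> K2 * (t - s) powr (2 * \<gamma>)"
    if "c \<le> s" "s \<le> t" "t \<le> b" for s t
    using germ_solutionD[OF Y2 that] that Yc by (simp add: euler_remainder_def)
  have inc: "increments_le \<gamma> L a c Y"
    using germ_solution_increments[OF \<gamma> increments_le_subinterval[OF X] \<phi> Y1 K(1)] c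
    by (auto simp: increments_le_def Y_def L_def)
  have K_ge: "K1 \<le> K" "K2 \<le> K" using K L0 by (auto simp: K_def)
  have "norm (euler_remainder \<phi> X Y s t) \<le> K * (t - s) powr (2 * \<gamma>)"
    if st: "a \<le> s" "s \<le> t" "t \<le> b" for s t
  proof -
    consider "t \<le> c" | "c \<le> s" | "s \<le> c" "c \<le> t" by linarith
    then show ?thesis
    proof cases
      case 1
      then show ?thesis using left[of s t] st K_ge by (meson mult_right_mono order_trans powr_ge_zero)
    next
      case 2
      then show ?thesis using right[of s t] st K_ge by (meson mult_right_mono order_trans powr_ge_zero)
    next
      case 3
      have "norm (blinfun_apply (\<phi> (Y c) - \<phi> (Y s)) (X t - X c)) \<le> B\<^sup>2 * L * (t - s) powr (2 * \<gamma>)"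
        using lipschitz_defect_le[OF \<gamma> \<phi> increments_leD[OF inc, of s c] increments_leD[OF X, of c t], of "t - s"]
          st 3 c L0 by simp
      moreover have "norm (euler_remainder \<phi> X Y s c) \<le> K1 * (t - s) powr (2 * \<gamma>)"
        by (rule order_trans[OF left mult_left_mono]) (use st 3 K \<gamma> in \<open>auto intro!: powr_mono2\<close>)
      moreover have "norm (euler_remainder \<phi> X Y c t) \<le> K2 * (t - s) powr (2 * \<gamma>)"
        by (rule order_trans[OF right mult_left_mono]) (use st 3 K \<gamma> in \<open>auto intro!: powr_mono2\<close>)
      moreover have "euler_remainder \<phi> X Y s t = euler_remainder \<phi> X Y s c
          + euler_remainder \<phi> X Y c t + blinfun_apply (\<phi> (Y c) - \<phi> (Y s)) (X t - X c)"
        using euler_remainder_defect[of \<phi> X Y s t c] by (simp add: algebra_simps)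
      ultimately show ?thesis
        by (simp only: K_def distrib_right norm_triangle_mono)
    qed
  qed
  hence "germ_solution \<gamma> \<phi> X K a b Y" by (simp add: germ_solution_def)
  moreover have "Y = (\<lambda>t. if t \<le> c then Y1 t else Y2 t)" by (rule ext) (rule Y_def)
  moreover have "0 \<le> K" using K L0 by (simp add: K_def)
  ultimately show thesis using that by simp
qed

text \<open>The remainders in the two time directions add up to
\<open>(\<phi> (Y t) - \<phi> (Y s)) (X t - X s)\<close>. Being a germ solution is thus invariant under time reversal, which
allows the initial condition at an interior time.\<close>

lemma germ_solution_reverse_le:
  assumes \<gamma>: "0 \<le> \<gamma>" and X: "increments_le \<gamma> B a b X" and \<phi>: "lipschitz_bounded B \<phi>"
    and Y: "germ_solution \<gamma> \<phi> X K a b Y" and L: "increments_le \<gamma> L a b Y" "0 \<le> L"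
    and st: "a \<le> s" "s \<le> t" "t \<le> b"
  shows "norm (euler_remainder \<phi> X Y t s) \<le> (K + B\<^sup>2 * L) * (t - s) powr (2 * \<gamma>)"
proof -
  have "norm (blinfun_apply (\<phi> (Y t) - \<phi> (Y s)) (X t - X s)) \<le> B\<^sup>2 * L * (t - s) powr (2 * \<gamma>)"
    using lipschitz_defect_le[OF \<gamma> \<phi> increments_leD[OF L(1) st] increments_leD[OF X st], of "t - s"] st L(2)
    by simp
  moreover have "euler_remainder \<phi> X Y t s
      = blinfun_apply (\<phi> (Y t) - \<phi> (Y s)) (X t - X s) - euler_remainder \<phi> X Y s t"
    by (simp add: euler_remainder_def blinfun.bilinear_simps algebra_simps)
  ultimately show ?thesis
    using germ_solutionD[OF Y st]
      norm_triangle_ineq4[of "blinfun_apply (\<phi> (Y t) - \<phi> (Y s)) (X t - X s)" "euler_remainder \<phi> X Y s t"]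
    by (simp add: distrib_right)
qed

lemma germ_solution_reverse:
  assumes \<gamma>: "0 \<le> \<gamma>" and X: "increments_le \<gamma> B a b X" and \<phi>: "lipschitz_bounded B \<phi>"
    and Y: "germ_solution \<gamma> \<phi> X K a b Y" and K: "0 \<le> K"
  obtains K' where "0 \<le> K'" "germ_solution \<gamma> \<phi> (\<lambda>t. X (- t)) K' (- b) (- a) (\<lambda>t. Y (- t))"
proof -
  define L where "L = B\<^sup>2 + K * (b - a) powr \<gamma>"
  have L: "increments_le \<gamma> L a b Y" "0 \<le> L"
    using germ_solution_increments[OF \<gamma> X \<phi> Y K] K by (auto simp: L_def)
  show thesis
  proof
    show "0 \<le> K + B\<^sup>2 * L" using K L by simp
    show "germ_solution \<gamma> \<phi> (\<lambda>t. X (- t)) (K + B\<^sup>2 * L) (- b) (- a) (\<lambda>t. Y (- t))"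
      unfolding germ_solution_def
    proof (intro allI impI)
      fix s t assume "- b \<le> s" "s \<le> t" "t \<le> - a"
      thus "norm (euler_remainder \<phi> (\<lambda>t. X (- t)) (\<lambda>t. Y (- t)) s t)
          \<le> (K + B\<^sup>2 * L) * (t - s) powr (2 * \<gamma>)"
        using germ_solution_reverse_le[OF \<gamma> X \<phi> Y L, of "- t" "- s"]
        by (simp add: euler_remainder_def)
    qed
  qed
qed

lemma exists_small_step:
  fixes \<gamma> \<eta> :: real
  assumes "0 < \<gamma>" "0 < \<eta>"
  obtains h where "0 < h" "h \<le> 1" "h powr \<gamma> \<le> \<eta>"
proof
  let ?h = "min 1 (\<eta> powr (1 / \<gamma>))"
  show "0 < ?h" "?h \<le> 1" using assms by auto
  have "?h powr \<gamma> \<le> (\<eta> powr (1 / \<gamma>)) powr \<gamma>" using assms by (intro powr_mono2) auto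
  also have "\<dots> = \<eta>" using assms by (simp add: powr_powr)
  finally show "?h powr \<gamma> \<le> \<eta>" .
qed

text \<open>The length of the intervals on which \<open>local_germ_solution\<close> applies depends on \<open>B\<close> and \<open>\<gamma>\<close>
but not on the initial value, so finitely many local solutions cover \<open>[a, b]\<close>.\<close>

lemma forward_germ_solution:
  fixes X :: "real \<Rightarrow> 'u::real_normed_vector" and \<phi> :: "'v::euclidean_space \<Rightarrow> 'u \<Rightarrow>\<^sub>L 'v"
  assumes \<gamma>: "1 / 2 < \<gamma>" and X: "increments_le \<gamma> B a b X" and \<phi>: "lipschitz_bounded B \<phi>" and ab: "a \<le> b"
  obtains Y K where "Y a = y0" "0 \<le> K" "germ_solution \<gamma> \<phi> X K a b Y"
proof -
  note B = lipschitz_boundedD[OF \<phi>]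
  define c where "c = 1 - 2 powr (1 - 2 * \<gamma>)"
  have c: "0 < c" using two_powr_gap[of "2 * \<gamma>"] \<gamma> by (simp add: c_def)
  obtain h where h: "0 < h" "h powr \<gamma> \<le> c / (4 * (B\<^sup>2 + 1))"
  proof (rule exists_small_step)
    show "0 < \<gamma>" using \<gamma> by simp
    show "0 < c / (4 * (B\<^sup>2 + 1))" using c by (intro divide_pos_pos) (auto simp: add_nonneg_pos)
  qed auto
  have "B\<^sup>2 * h powr \<gamma> \<le> (B\<^sup>2 + 1) * (c / (4 * (B\<^sup>2 + 1)))"
    using h by (intro mult_mono) auto
  also have "\<dots> = c / 4" by (simp add: add_nonneg_eq_0_iff field_simps)
  finally have small: "2 powr (1 - 2 * \<gamma>) + 2 * (B\<^sup>2 * h powr \<gamma>) < 1" using c by (simp add: c_def)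
  have \<gamma>0: "0 \<le> \<gamma>" using \<gamma> by simp
  have "\<exists>Y K. Y a = y0 \<and> 0 \<le> K \<and> germ_solution \<gamma> \<phi> X K a b' Y"
    if "a \<le> b'" "b' \<le> b" "b' - a \<le> real n * h" for n b'
    using that
  proof (induction n arbitrary: b')
    case 0
    have "b' - a \<le> h" using 0 h by simp
    then obtain Y K where "Y a = y0" "0 \<le> K" "germ_solution \<gamma> \<phi> X K a b' Y"
      using local_germ_solution[OF \<gamma>0 increments_le_subinterval[OF X order_refl 0(2)] \<phi> _ small 0(1)] by metis
    thus ?case by blast
  next
    case (Suc n)
    define m where "m = max a (b' - h)"
    have m: "a \<le> m" "m \<le> b'" "m - a \<le> real n * h" "b' - m \<le> h"
      using Suc.prems h by (auto simp: m_def algebra_simps)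
    have X': "increments_le \<gamma> B m b' X" "increments_le \<gamma> B a b' X"
      using increments_le_subinterval[OF X] m Suc.prems by auto
    obtain Y1 K1 where Y1: "Y1 a = y0" "0 \<le> K1" "germ_solution \<gamma> \<phi> X K1 a m Y1"
      using Suc.IH[of m] m Suc.prems by auto
    obtain Y2 K2 where Y2: "Y2 m = Y1 m" "0 \<le> K2" "germ_solution \<gamma> \<phi> X K2 m b' Y2"
      using local_germ_solution[OF \<gamma>0 X'(1) \<phi> m(4) small m(2)] by metis
    obtain K where "0 \<le> K" "germ_solution \<gamma> \<phi> X K a b' (\<lambda>t. if t \<le> m then Y1 t else Y2 t)"
      using germ_solution_concat[OF \<gamma>0 X'(2) \<phi> Y1(3) Y2(3) Y1(2) Y2(2) m(1,2) Y2(1)[symmetric]] by metis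
    thus ?case using Y1 m by (intro exI[of _ "\<lambda>t. if t \<le> m then Y1 t else Y2 t"]) auto
  qed
  moreover obtain n :: nat where "(b - a) / h \<le> real n" using real_arch_simple by blast
  ultimately obtain Y K where "Y a = y0" "0 \<le> K" "germ_solution \<gamma> \<phi> X K a b Y"
    using ab h by (metis order_refl pos_divide_le_eq)
  thus thesis by (rule that)
qed

lemma germ_solution_exists:
  fixes X :: "real \<Rightarrow> 'u::real_normed_vector" and \<phi> :: "'v::euclidean_space \<Rightarrow> 'u \<Rightarrow>\<^sub>L 'v"
  assumes \<gamma>: "1 / 2 < \<gamma>" and X: "increments_le \<gamma> B a b X" and \<phi>: "lipschitz_bounded B \<phi>"
    and t0: "a \<le> t0" "t0 \<le> b"
  obtains Y K where "Y t0 = y0" "0 \<le> K" "germ_solution \<gamma> \<phi> X K a b Y"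
proof -
  have \<gamma>0: "0 \<le> \<gamma>" using \<gamma> by simp
  have X_rev: "increments_le \<gamma> B (- t0) (- a) (\<lambda>t. X (- t))"
    unfolding increments_le_def
  proof (intro allI impI)
    fix s t assume "- t0 \<le> s" "s \<le> t" "t \<le> - a"
    thus "norm (X (- t) - X (- s)) \<le> B * (t - s) powr \<gamma>"
      using increments_leD[OF X, of "- t" "- s"] t0 by (simp add: norm_minus_commute)
  qed
  obtain Z K where Z: "Z (- t0) = y0" "0 \<le> K" "germ_solution \<gamma> \<phi> (\<lambda>t. X (- t)) K (- t0) (- a) Z"
    using forward_germ_solution[OF \<gamma> X_rev \<phi>] t0 by auto
  obtain K1 where Y1: "0 \<le> K1" "germ_solution \<gamma> \<phi> X K1 a t0 (\<lambda>t. Z (- t))"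
    using germ_solution_reverse[OF \<gamma>0 X_rev \<phi> Z(3,2)] by auto
  obtain Y2 K2 where Y2: "Y2 t0 = y0" "0 \<le> K2" "germ_solution \<gamma> \<phi> X K2 t0 b Y2"
    using forward_germ_solution[OF \<gamma> increments_le_subinterval[OF X, of t0 b] \<phi>] t0 by auto
  obtain K where "0 \<le> K" "germ_solution \<gamma> \<phi> X K a b (\<lambda>t. if t \<le> t0 then Z (- t) else Y2 t)"
    using germ_solution_concat[OF \<gamma>0 X \<phi> Y1(2) Y2(3) Y1(1) Y2(2) t0] Z(1) Y2(1) by auto
  thus thesis using that[of "\<lambda>t. if t \<le> t0 then Z (- t) else Y2 t" K] Z(1) by simp
qed

section \<open>Stability of germ solutions\<close>

text \<open>The regularity of \<open>\<phi>\<close> that stability requires. If \<open>x\<close>, \<open>x'\<close> are the values of one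
solution at two times and \<open>z\<close>, \<open>z'\<close> those of another, then the left side is the increment of
\<open>\<phi> (Y t) - \<phi> (Y' t)\<close>, the first term on the right the increment of \<open>Y - Y'\<close>, and the last
factor the distance of the two solutions.\<close>

definition four_point_holder ::
    "real \<Rightarrow> real \<Rightarrow> ('v::real_normed_vector \<Rightarrow> 'w::real_normed_vector) \<Rightarrow> bool" where
  "four_point_holder \<theta> B \<phi> \<longleftrightarrow> (\<forall>x x' z z'.
     norm (\<phi> x - \<phi> x' - \<phi> z + \<phi> z')
       \<le> B * norm (x - x' - z + z') + B * (norm (x - x') + norm (z - z')) powr \<theta> * norm (x' - z'))"

text \<open>The constant of a germ solution can be replaced by one that depends only on the data.\<close>

lemma local_apriori_bound:
  assumes \<gamma>: "1 / 2 < \<gamma>" and X: "increments_le \<gamma> B p q X" and \<phi>: "lipschitz_bounded B \<phi>"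
    and Y: "germ_solution \<gamma> \<phi> X K p q Y"
    and h: "q - p \<le> h" and small: "B\<^sup>2 * h powr \<gamma> \<le> (1 - 2 powr (1 - 2 * \<gamma>)) / 2"
  shows "germ_solution \<gamma> \<phi> X (2 * B ^ 4 / (1 - 2 powr (1 - 2 * \<gamma>))) p q Y"
  unfolding germ_solution_def
proof (intro allI impI)
  fix s t assume st: "p \<le> s" "s \<le> t" "t \<le> q"
  define c where "c = 1 - 2 powr (1 - 2 * \<gamma>)"
  define \<kappa> where "\<kappa> = B\<^sup>2 * h powr \<gamma>"
  have c: "0 < c" using two_powr_gap[of "2 * \<gamma>"] \<gamma> by (simp add: c_def)
  have \<kappa>: "0 \<le> \<kappa>" "\<kappa> \<le> c / 2" using small by (auto simp: \<kappa>_def c_def)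
  note B = lipschitz_boundedD(3)[OF \<phi>]
  have "norm (euler_remainder \<phi> X Y s t) \<le> B ^ 4 / (1 - \<kappa> - 2 powr (1 - 2 * \<gamma>)) * (t - s) powr (2 * \<gamma>)"
  proof (rule defect_absorption[where N = K, OF _ \<kappa>(1) _ _ _ st])
    show "0 \<le> B ^ 4" using B by simp
    show "2 powr (1 - 2 * \<gamma>) + \<kappa> < 1" using \<kappa> c by (simp add: c_def)
    show "norm (euler_remainder \<phi> X Y s t) \<le> K * (t - s) powr (2 * \<gamma>)"
      if "p \<le> s" "s \<le> t" "t \<le> q" for s t
      using germ_solutionD[OF Y that] .
    fix M s u t
    assume M: "0 \<le> M" and bound: "\<And>s t. p \<le> s \<Longrightarrow> s \<le> t \<Longrightarrow> t \<le> q \<Longrightarrow>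
        norm (euler_remainder \<phi> X Y s t) \<le> M * (t - s) powr (2 * \<gamma>)"
      and st: "p \<le> s" "s \<le> u" "u \<le> t" "t \<le> q"
    have "germ_solution \<gamma> \<phi> X M p q Y" using bound by (simp add: germ_solution_def)
    from germ_solution_increments[OF _ X \<phi> this M]
    have "increments_le \<gamma> (B\<^sup>2 + M * (q - p) powr \<gamma>) p q Y" using \<gamma> by simp
    moreover have "B\<^sup>2 + M * (q - p) powr \<gamma> \<le> B\<^sup>2 + M * h powr \<gamma>"
      using h st M \<gamma> by (intro add_left_mono mult_left_mono powr_mono2) auto
    ultimately have inc: "norm (Y u - Y s) \<le> (B\<^sup>2 + M * h powr \<gamma>) * (u - s) powr \<gamma>"
      using st by (meson increments_leD mult_right_mono order_trans powr_ge_zero)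
    have "norm (blinfun_apply (\<phi> (Y u) - \<phi> (Y s)) (X t - X u))
        \<le> B\<^sup>2 * (B\<^sup>2 + M * h powr \<gamma>) * (t - s) powr (2 * \<gamma>)"
      by (rule lipschitz_defect_le[OF _ \<phi> inc increments_leD[OF X]]) (use st \<gamma> M in auto)
    also have "B\<^sup>2 * (B\<^sup>2 + M * h powr \<gamma>) = B ^ 4 + \<kappa> * M"
      by (simp add: \<kappa>_def algebra_simps power2_eq_square power4_eq_xxxx)
    finally show "norm (euler_remainder \<phi> X Y s t - euler_remainder \<phi> X Y s u - euler_remainder \<phi> X Y u t)
        \<le> (B ^ 4 + \<kappa> * M) * (t - s) powr (2 * \<gamma>)"
      by (simp only: euler_remainder_defect)
  qed
  also have "\<dots> \<le> B ^ 4 / (c / 2) * (t - s) powr (2 * \<gamma>)"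
    using \<kappa> c by (intro mult_right_mono divide_left_mono) (auto simp: c_def)
  finally show "norm (euler_remainder \<phi> X Y s t)
      \<le> 2 * B ^ 4 / (1 - 2 powr (1 - 2 * \<gamma>)) * (t - s) powr (2 * \<gamma>)"
    by (simp add: c_def mult.commute)
qed

text \<open>The defect of the difference of two remainders over \<open>[s, t]\<close>, with \<open>x\<close>, \<open>x'\<close> standing for
the increments of the drivers over \<open>[u, t]\<close>, and \<open>y0\<close>, \<open>y1\<close> for the values of a solution
at \<open>s\<close> and \<open>u\<close>; \<open>v\<close> and \<open>w\<close> are the lengths of \<open>[s, u]\<close> and
\<open>[u, t]\<close>. It is split so that each term contains one small factor: a second difference of
\<open>\<phi>\<close>, an increment of \<open>\<phi> - \<phi>'\<close>, or an increment of \<open>X - X'\<close>.\<close>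

lemma difference_defect_le:
  assumes \<gamma>: "0 < \<gamma>" and \<theta>: "0 < \<theta>" "\<theta> < 1" and B: "1 \<le> B" and L: "1 \<le> L"
    and X: "norm x \<le> B * w powr \<gamma>" and dX: "norm (x - x') \<le> \<epsilon> * w powr \<gamma>"
    and \<phi>: "four_point_holder \<theta> B \<phi>" and \<phi>': "lipschitz_bounded B \<phi>'"
    and d\<phi>: "lipschitz_bounded \<epsilon> (\<lambda>x. \<phi> x - \<phi>' x)"
    and y: "norm (y1 - y0) \<le> L * v powr \<gamma>" "norm (y1' - y0') \<le> L * v powr \<gamma>"
    and D: "norm (y0 - y0') \<le> S"
    and dD: "norm ((y1 - y1') - (y0 - y0')) \<le> 2 * B\<^sup>2 * (S + \<epsilon>) * v powr \<gamma> + M * v powr ((1 + \<theta>) * \<gamma>)"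
    and r: "0 \<le> v" "v \<le> r" "0 \<le> w" "w \<le> r" "r \<le> h" "r \<le> 1" and M: "0 \<le> M"
  shows "norm (blinfun_apply (\<phi> y1 - \<phi> y0) x - blinfun_apply (\<phi>' y1' - \<phi>' y0') x')
    \<le> ((2 * B ^ 4 + 2 * L * B\<^sup>2) * (S + \<epsilon>) + B\<^sup>2 * h powr \<gamma> * M) * r powr ((1 + \<theta>) * \<gamma>)"
proof -
  define \<rho> where "\<rho> = (1 + \<theta>) * \<gamma>"
  have S: "0 \<le> S" using order_trans[OF norm_ge_zero D] .
  have \<epsilon>: "0 \<le> \<epsilon>" using lipschitz_boundedD(3)[OF d\<phi>] .
  have vr: "v powr \<alpha> \<le> r powr \<alpha>" and wr: "w powr \<alpha> \<le> r powr \<alpha>" if "0 \<le> \<alpha>" for \<alpha>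
    using that r by (auto intro: powr_mono2)
  have "v powr \<gamma> * w powr \<gamma> \<le> r powr \<gamma> * r powr \<gamma>"
    using vr[of \<gamma>] wr[of \<gamma>] \<gamma> by (intro mult_mono) auto
  also have "\<dots> = r powr (2 * \<gamma>)" by (simp flip: powr_add)
  also have "\<dots> \<le> r powr \<rho>"
    using r \<gamma> \<theta> by (intro powr_mono') (auto simp: \<rho>_def algebra_simps)
  finally have e1: "v powr \<gamma> * w powr \<gamma> \<le> r powr \<rho>" .
  have e2: "v powr \<rho> * w powr \<gamma> \<le> r powr \<rho> * h powr \<gamma>"
    using vr[of \<rho>] powr_mono2[of \<gamma> w h] r \<gamma> \<theta> by (intro mult_mono) (auto simp: \<rho>_def)
  have "v powr (\<gamma> * \<theta>) * w powr \<gamma> \<le> r powr (\<gamma> * \<theta>) * r powr \<gamma>"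
    using vr[of "\<gamma> * \<theta>"] wr[of \<gamma>] \<gamma> \<theta> by (intro mult_mono) auto
  also have "\<dots> = r powr \<rho>" by (simp add: \<rho>_def algebra_simps flip: powr_add)
  finally have e3: "v powr (\<gamma> * \<theta>) * w powr \<gamma> \<le> r powr \<rho>" .
  have fp: "norm (\<phi> y1 - \<phi> y0 - \<phi> y1' + \<phi> y0')
      \<le> B * (2 * B\<^sup>2 * (S + \<epsilon>) * v powr \<gamma> + M * v powr \<rho>) + B * (2 * L * v powr (\<gamma> * \<theta>)) * S"
  proof -
    have "norm (\<phi> y1 - \<phi> y0 - \<phi> y1' + \<phi> y0') \<le> B * norm (y1 - y0 - y1' + y0')
        + B * (norm (y1 - y0) + norm (y1' - y0')) powr \<theta> * norm (y0 - y0')"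
      using \<phi> by (auto simp: four_point_holder_def)
    also have "y1 - y0 - y1' + y0' = (y1 - y1') - (y0 - y0')" by simp
    also have "(norm (y1 - y0) + norm (y1' - y0')) powr \<theta> \<le> 2 * L * v powr (\<gamma> * \<theta>)"
    proof -
      have "(norm (y1 - y0) + norm (y1' - y0')) powr \<theta> \<le> (2 * L * v powr \<gamma>) powr \<theta>"
        using y \<theta> by (intro powr_mono2) auto
      also have "\<dots> = (2 * L) powr \<theta> * v powr (\<gamma> * \<theta>)"
        using L by (simp add: powr_mult powr_powr)
      also have "(2 * L) powr \<theta> \<le> (2 * L) powr 1" using L \<theta> by (intro powr_mono) auto
      finally show ?thesis using L by (simp add: mult_right_mono)
    qed
    finally have "norm (\<phi> y1 - \<phi> y0 - \<phi> y1' + \<phi> y0') \<le> B * norm ((y1 - y1') - (y0 - y0'))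
        + B * (2 * L * v powr (\<gamma> * \<theta>)) * norm (y0 - y0')"
      using B by (simp add: mult_left_mono mult_right_mono)
    also have "\<dots> \<le> B * (2 * B\<^sup>2 * (S + \<epsilon>) * v powr \<gamma> + M * v powr \<rho>)
        + B * (2 * L * v powr (\<gamma> * \<theta>)) * S"
      using dD D B L by (intro add_mono mult_left_mono) (auto simp: \<rho>_def)
    finally show ?thesis .
  qed
  have t1: "norm (blinfun_apply (\<phi> y1 - \<phi> y0 - \<phi> y1' + \<phi> y0') x)
      \<le> (2 * B ^ 4 * (S + \<epsilon>) + B\<^sup>2 * h powr \<gamma> * M + 2 * L * B\<^sup>2 * S) * r powr \<rho>"
  proof -
    have "norm (blinfun_apply (\<phi> y1 - \<phi> y0 - \<phi> y1' + \<phi> y0') x)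
      \<le> (B * (2 * B\<^sup>2 * (S + \<epsilon>) * v powr \<gamma> + M * v powr \<rho>) + B * (2 * L * v powr (\<gamma> * \<theta>)) * S)
        * (B * w powr \<gamma>)"
      by (rule blinfun_apply_le[OF fp X])
    also have "\<dots> = 2 * B ^ 4 * (S + \<epsilon>) * (v powr \<gamma> * w powr \<gamma>) + B\<^sup>2 * M * (v powr \<rho> * w powr \<gamma>)
        + 2 * L * B\<^sup>2 * S * (v powr (\<gamma> * \<theta>) * w powr \<gamma>)"
      by (simp add: algebra_simps power2_eq_square power4_eq_xxxx)
    also have "\<dots> \<le> 2 * B ^ 4 * (S + \<epsilon>) * r powr \<rho> + B\<^sup>2 * M * (r powr \<rho> * h powr \<gamma>)
        + 2 * L * B\<^sup>2 * S * r powr \<rho>"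
      using e1 e2 e3 B L S \<epsilon> M by (intro add_mono mult_left_mono) auto
    finally show ?thesis by (simp add: algebra_simps)
  qed
  have t2: "norm (blinfun_apply ((\<phi> y1' - \<phi>' y1') - (\<phi> y0' - \<phi>' y0')) x) \<le> L * B\<^sup>2 * \<epsilon> * r powr \<rho>"
  proof -
    have "norm ((\<phi> y1' - \<phi>' y1') - (\<phi> y0' - \<phi>' y0')) \<le> \<epsilon> * (L * v powr \<gamma>)"
      using lipschitz_boundedD(2)[OF d\<phi>, of y1' y0'] mult_left_mono[OF y(2) \<epsilon>] by linarith
    from blinfun_apply_le[OF this X]
    have "norm (blinfun_apply ((\<phi> y1' - \<phi>' y1') - (\<phi> y0' - \<phi>' y0')) x)
        \<le> L * B * \<epsilon> * (v powr \<gamma> * w powr \<gamma>)" by (simp add: algebra_simps)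
    also have "\<dots> \<le> L * B\<^sup>2 * \<epsilon> * r powr \<rho>"
      using e1 B L \<epsilon> by (intro mult_mono mult_left_mono) (auto simp: power2_eq_square)
    finally show ?thesis .
  qed
  have t3: "norm (blinfun_apply (\<phi>' y1' - \<phi>' y0') (x - x')) \<le> L * B\<^sup>2 * \<epsilon> * r powr \<rho>"
  proof -
    have "norm (\<phi>' y1' - \<phi>' y0') \<le> B * (L * v powr \<gamma>)"
      using lipschitz_boundedD(2)[OF \<phi>', of y1' y0'] mult_left_mono[OF y(2), of B] B by linarith
    from blinfun_apply_le[OF this dX]
    have "norm (blinfun_apply (\<phi>' y1' - \<phi>' y0') (x - x')) \<le> L * B * \<epsilon> * (v powr \<gamma> * w powr \<gamma>)"
      by (simp add: algebra_simps)
    also have "\<dots> \<le> L * B\<^sup>2 * \<epsilon> * r powr \<rho>"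
      using e1 B L \<epsilon> by (intro mult_mono mult_left_mono) (auto simp: power2_eq_square)
    finally show ?thesis .
  qed
  have "blinfun_apply (\<phi> y1 - \<phi> y0) x - blinfun_apply (\<phi>' y1' - \<phi>' y0') x'
      = blinfun_apply (\<phi> y1 - \<phi> y0 - \<phi> y1' + \<phi> y0') x
        + blinfun_apply ((\<phi> y1' - \<phi>' y1') - (\<phi> y0' - \<phi>' y0')) x
        + blinfun_apply (\<phi>' y1' - \<phi>' y0') (x - x')"
    by (simp add: blinfun.bilinear_simps algebra_simps)
  hence "norm (blinfun_apply (\<phi> y1 - \<phi> y0) x - blinfun_apply (\<phi>' y1' - \<phi>' y0') x')
    \<le> (2 * B ^ 4 * (S + \<epsilon>) + B\<^sup>2 * h powr \<gamma> * M + 2 * L * B\<^sup>2 * S) * r powr \<rho>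
      + L * B\<^sup>2 * \<epsilon> * r powr \<rho> + L * B\<^sup>2 * \<epsilon> * r powr \<rho>"
    using t1 t2 t3 by (simp only: norm_triangle_mono)
  thus ?thesis by (simp add: \<rho>_def algebra_simps)
qed

text \<open>\<open>defect_absorption\<close> for the difference of the two remainders, with the supremum \<open>S\<close> of the distance
of the solutions treated as given. The estimate becomes self-contained in \<open>local_propagation\<close>, since
\<open>S\<close> is in turn controlled by one value of the difference and its increments.\<close>

lemma local_stability:
  assumes \<gamma>: "0 < \<gamma>" and \<theta>: "0 < \<theta>" "\<theta> < 1" and \<rho>: "1 < (1 + \<theta>) * \<gamma>" and B: "1 \<le> B" and L: "1 \<le> L"
    and X: "increments_le \<gamma> B p q X" and dX: "increments_le \<gamma> \<epsilon> p q (\<lambda>t. X t - X' t)"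
    and \<phi>: "lipschitz_bounded B \<phi>" "four_point_holder \<theta> B \<phi>" and \<phi>': "lipschitz_bounded B \<phi>'"
    and d\<phi>: "lipschitz_bounded \<epsilon> (\<lambda>x. \<phi> x - \<phi>' x)"
    and Y: "increments_le \<gamma> L p q Y" "germ_solution \<gamma> \<phi> X K p q Y"
    and Y': "increments_le \<gamma> L p q Y'" "germ_solution \<gamma> \<phi>' X' K p q Y'" and K: "0 \<le> K"
    and h: "q - p \<le> h" "h \<le> 1" and small: "B\<^sup>2 * h powr \<gamma> \<le> (1 - 2 powr (1 - (1 + \<theta>) * \<gamma>)) / 2"
    and S: "\<And>t. p \<le> t \<Longrightarrow> t \<le> q \<Longrightarrow> norm (Y t - Y' t) \<le> S"
    and st: "p \<le> s" "s \<le> t" "t \<le> q"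
  shows "norm ((Y t - Y' t) - (Y s - Y' s))
    \<le> (2 * B\<^sup>2 + 2 * (2 * B ^ 4 + 2 * L * B\<^sup>2) / (1 - 2 powr (1 - (1 + \<theta>) * \<gamma>))) * (S + \<epsilon>) * (t - s) powr \<gamma>"
proof -
  define \<rho>' where "\<rho>' = (1 + \<theta>) * \<gamma>"
  define c where "c = 1 - 2 powr (1 - \<rho>')"
  define \<kappa> where "\<kappa> = B\<^sup>2 * h powr \<gamma>"
  define E where "E = 2 * B ^ 4 + 2 * L * B\<^sup>2"
  define R where "R s t = euler_remainder \<phi> X Y s t - euler_remainder \<phi>' X' Y' s t" for s t
  have c: "0 < c" using two_powr_gap[OF \<rho>] by (simp add: c_def \<rho>'_def)
  have \<kappa>: "0 \<le> \<kappa>" "\<kappa> \<le> c / 2" using small by (auto simp: \<kappa>_def c_def \<rho>'_def)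
  have \<epsilon>: "0 \<le> \<epsilon>" using lipschitz_boundedD(3)[OF d\<phi>] .
  have S0: "0 \<le> S" using order_trans[OF norm_ge_zero S] st by (meson order_trans)
  have E0: "0 \<le> E" using B L by (simp add: E_def)
  have increment: "norm ((Y t - Y' t) - (Y s - Y' s)) \<le> 2 * B\<^sup>2 * (S + \<epsilon>) * (t - s) powr \<gamma> + N"
    if st: "p \<le> s" "s \<le> t" "t \<le> q" and N: "norm (R s t) \<le> N" for s t N
  proof -
    have "(Y t - Y' t) - (Y s - Y' s) = blinfun_apply (\<phi> (Y s) - \<phi> (Y' s)) (X t - X s)
        + blinfun_apply (\<phi> (Y' s) - \<phi>' (Y' s)) (X t - X s)
        + blinfun_apply (\<phi>' (Y' s)) ((X t - X' t) - (X s - X' s)) + R s t"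
      by (simp add: R_def euler_remainder_def blinfun.bilinear_simps algebra_simps)
    moreover have "norm (blinfun_apply (\<phi> (Y s) - \<phi> (Y' s)) (X t - X s)) \<le> (B * S) * (B * (t - s) powr \<gamma>)"
    proof (rule blinfun_apply_increment_le[OF _ X st])
      show "norm (\<phi> (Y s) - \<phi> (Y' s)) \<le> B * S"
        using lipschitz_boundedD(2)[OF \<phi>(1), of "Y s" "Y' s"] mult_left_mono[OF S[of s], of B] st B by linarith
    qed
    moreover have "norm (blinfun_apply (\<phi> (Y' s) - \<phi>' (Y' s)) (X t - X s)) \<le> \<epsilon> * (B * (t - s) powr \<gamma>)"
      by (rule blinfun_apply_increment_le[OF lipschitz_boundedD(1)[OF d\<phi>] X st])
    moreover have "norm (blinfun_apply (\<phi>' (Y' s)) ((X t - X' t) - (X s - X' s))) \<le> B * (\<epsilon> * (t - s) powr \<gamma>)"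
      by (rule blinfun_apply_increment_le[OF lipschitz_boundedD(1)[OF \<phi>'] dX st])
    ultimately have "norm ((Y t - Y' t) - (Y s - Y' s))
        \<le> (B * S) * (B * (t - s) powr \<gamma>) + \<epsilon> * (B * (t - s) powr \<gamma>) + B * (\<epsilon> * (t - s) powr \<gamma>) + N"
      using N by (simp only: norm_triangle_mono)
    also have "\<dots> = (B\<^sup>2 * S + 2 * B * \<epsilon>) * (t - s) powr \<gamma> + N"
      by (simp add: algebra_simps power2_eq_square)
    also have "\<dots> \<le> 2 * B\<^sup>2 * (S + \<epsilon>) * (t - s) powr \<gamma> + N"
    proof -
      have "B * \<epsilon> \<le> B\<^sup>2 * \<epsilon>" using B \<epsilon> by (intro mult_right_mono) (auto simp: power2_eq_square)
      moreover have "0 \<le> B\<^sup>2 * S" using S0 by simp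
      ultimately have "B\<^sup>2 * S + 2 * B * \<epsilon> \<le> 2 * B\<^sup>2 * (S + \<epsilon>)" by (simp add: algebra_simps)
      thus ?thesis by (intro add_right_mono mult_right_mono) auto
    qed
    finally show ?thesis .
  qed
  have R: "norm (R s t) \<le> E * (S + \<epsilon>) / (1 - \<kappa> - 2 powr (1 - \<rho>')) * (t - s) powr \<rho>'"
  proof (rule defect_absorption[where N = "2 * K", OF _ \<kappa>(1) _ _ _ st])
    show "0 \<le> E * (S + \<epsilon>)" using E0 S0 \<epsilon> by simp
    show "2 powr (1 - \<rho>') + \<kappa> < 1" using \<kappa> c by (simp add: c_def)
    show "norm (R s t) \<le> 2 * K * (t - s) powr \<rho>'" if st: "p \<le> s" "s \<le> t" "t \<le> q" for s t
    proof -
      have "norm (R s t) \<le> K * (t - s) powr (2 * \<gamma>) + K * (t - s) powr (2 * \<gamma>)"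
        unfolding R_def using germ_solutionD[OF Y(2) st] germ_solutionD[OF Y'(2) st]
        by (meson add_mono norm_triangle_ineq4 order_trans)
      also have "\<dots> = 2 * K * (t - s) powr (2 * \<gamma>)" by simp
      also have "\<dots> \<le> 2 * K * (t - s) powr \<rho>'"
        using K st h \<theta> \<gamma> by (intro mult_left_mono powr_mono') (auto simp: \<rho>'_def algebra_simps)
      finally show ?thesis .
    qed
    fix M s u t
    assume M: "0 \<le> M" and bound: "\<And>s t. p \<le> s \<Longrightarrow> s \<le> t \<Longrightarrow> t \<le> q \<Longrightarrow> norm (R s t) \<le> M * (t - s) powr \<rho>'"
      and st: "p \<le> s" "s \<le> u" "u \<le> t" "t \<le> q"
    have "norm (blinfun_apply (\<phi> (Y u) - \<phi> (Y s)) (X t - X u)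
          - blinfun_apply (\<phi>' (Y' u) - \<phi>' (Y' s)) (X' t - X' u))
        \<le> ((2 * B ^ 4 + 2 * L * B\<^sup>2) * (S + \<epsilon>) + B\<^sup>2 * h powr \<gamma> * M) * (t - s) powr ((1 + \<theta>) * \<gamma>)"
    proof (rule difference_defect_le[OF \<gamma> \<theta> B L _ _ \<phi>(2) \<phi>' d\<phi>])
      show "norm (X t - X u) \<le> B * (t - u) powr \<gamma>" using increments_leD[OF X] st by simp
      show "norm (X t - X u - (X' t - X' u)) \<le> \<epsilon> * (t - u) powr \<gamma>"
        using increments_leD[OF dX, of u t] st by (simp add: algebra_simps)
      show "norm (Y u - Y s) \<le> L * (u - s) powr \<gamma>" using increments_leD[OF Y(1)] st by simp
      show "norm (Y' u - Y' s) \<le> L * (u - s) powr \<gamma>" using increments_leD[OF Y'(1)] st by simp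
      show "norm (Y s - Y' s) \<le> S" using S st by simp
      show "norm (Y u - Y' u - (Y s - Y' s))
          \<le> 2 * B\<^sup>2 * (S + \<epsilon>) * (u - s) powr \<gamma> + M * (u - s) powr ((1 + \<theta>) * \<gamma>)"
        by (rule increment) (use st bound[of s u] in \<open>auto simp: \<rho>'_def\<close>)
    qed (use st h M in auto)
    thus "norm (R s t - R s u - R u t) \<le> (E * (S + \<epsilon>) + \<kappa> * M) * (t - s) powr \<rho>'"
      by (simp add: R_def E_def \<kappa>_def \<rho>'_def algebra_simps flip: euler_remainder_defect)
  qed
  also have "\<dots> \<le> E * (S + \<epsilon>) / (c / 2) * (t - s) powr \<gamma>"
  proof (rule mult_mono)
    show "E * (S + \<epsilon>) / (1 - \<kappa> - 2 powr (1 - \<rho>')) \<le> E * (S + \<epsilon>) / (c / 2)"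
      using \<kappa> c E0 S0 \<epsilon> by (intro divide_left_mono) (auto simp: c_def)
    show "(t - s) powr \<rho>' \<le> (t - s) powr \<gamma>"
      using st h \<theta> \<gamma> by (intro powr_mono') (auto simp: \<rho>'_def algebra_simps)
  qed (use c E0 S0 \<epsilon> in auto)
  finally have "norm ((Y t - Y' t) - (Y s - Y' s))
      \<le> 2 * B\<^sup>2 * (S + \<epsilon>) * (t - s) powr \<gamma> + E * (S + \<epsilon>) / (c / 2) * (t - s) powr \<gamma>"
    by (rule increment[OF st])
  also have "\<dots> = (2 * B\<^sup>2 + 2 * E / c) * (S + \<epsilon>) * (t - s) powr \<gamma>"
    by (simp add: algebra_simps)
  finally show ?thesis by (simp only: E_def c_def \<rho>'_def)
qed

text \<open>The increments of \<open>D\<close> on the window are at most \<open>(S + \<epsilon>) / 2\<close> with \<open>S\<close> the supremum of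
its norm, so \<open>S\<close> is at most \<open>norm (D r) + (S + \<epsilon>) / 2\<close>, and \<open>S\<close> can be absorbed.\<close>

lemma local_propagation:
  fixes D :: "real \<Rightarrow> 'v::real_normed_vector"
  assumes G: "\<And>S s t. (\<And>t. p \<le> t \<Longrightarrow> t \<le> q \<Longrightarrow> norm (D t) \<le> S) \<Longrightarrow> p \<le> s \<Longrightarrow> s \<le> t \<Longrightarrow> t \<le> q \<Longrightarrow>
        norm (D t - D s) \<le> G * (S + \<epsilon>) * (t - s) powr \<gamma>"
    and bounded: "\<And>t. p \<le> t \<Longrightarrow> t \<le> q \<Longrightarrow> norm (D t) \<le> S0"
    and h: "q - p \<le> h" and small: "G * h powr \<gamma> \<le> 1 / 2" and \<gamma>: "0 < \<gamma>" and nonneg: "0 \<le> G" "0 \<le> \<epsilon>"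
    and rt: "p \<le> r" "r \<le> q" "p \<le> t" "t \<le> q"
  shows "norm (D t) \<le> 2 * norm (D r) + \<epsilon>"
proof -
  define S where "S = Sup ((\<lambda>t. norm (D t)) ` {p..q})"
  have bdd: "bdd_above ((\<lambda>t. norm (D t)) ` {p..q})" using bounded by (intro bdd_aboveI2) auto
  have S: "norm (D t) \<le> S" if "p \<le> t" "t \<le> q" for t
    unfolding S_def using that by (intro cSup_upper[OF _ bdd]) auto
  have S_nonneg: "0 \<le> S" using order_trans[OF norm_ge_zero S] rt by blast
  have inc: "norm (D t - D r) \<le> (S + \<epsilon>) / 2" if "p \<le> t" "t \<le> q" for t
  proof -
    have *: "norm (D v - D u) \<le> (S + \<epsilon>) / 2" if "p \<le> u" "u \<le> v" "v \<le> q" for u v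
    proof -
      have "norm (D v - D u) \<le> G * (S + \<epsilon>) * (v - u) powr \<gamma>" using G[OF S that] .
      also have "\<dots> \<le> G * (S + \<epsilon>) * h powr \<gamma>"
        using that h \<gamma> nonneg S_nonneg by (intro mult_left_mono powr_mono2) auto
      also have "\<dots> \<le> 1 / 2 * (S + \<epsilon>)"
        using mult_right_mono[OF small, of "S + \<epsilon>"] nonneg S_nonneg by (simp add: algebra_simps)
      finally show ?thesis by simp
    qed
    show ?thesis using *[of r t] *[of t r] that rt by (cases "r \<le> t") (auto simp: norm_minus_commute)
  qed
  have "S \<le> norm (D r) + (S + \<epsilon>) / 2"
    unfolding S_def
  proof (rule cSup_least)
    fix x assume "x \<in> (\<lambda>t. norm (D t)) ` {p..q}"
    then obtain t where "p \<le> t" "t \<le> q" "x = norm (D t)" by auto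
    thus "x \<le> norm (D r) + (Sup ((\<lambda>t. norm (D t)) ` {p..q}) + \<epsilon>) / 2"
      using inc[of t] norm_triangle_ineq2[of "D t" "D r"] unfolding S_def by linarith
  qed (use rt in auto)
  thus ?thesis using S[OF rt(3,4)] by argo
qed

text \<open>Moving from \<open>t0\<close> to \<open>t\<close> in \<open>n\<close> steps of length at most \<open>h\<close>. The factor is
\<open>3\<close> rather than \<open>2\<close> because each step also adds \<open>\<epsilon>\<close>.\<close>

lemma chain_propagation:
  fixes D :: "real \<Rightarrow> 'v::real_normed_vector"
  assumes step: "\<And>r t. a \<le> r \<Longrightarrow> r \<le> b \<Longrightarrow> a \<le> t \<Longrightarrow> t \<le> b \<Longrightarrow> \<bar>t - r\<bar> \<le> h \<Longrightarrow> norm (D t) \<le> 2 * norm (D r) + \<epsilon>"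
    and h: "0 < h" and \<epsilon>: "0 \<le> \<epsilon>" and t0: "a \<le> t0" "t0 \<le> b"
    and t: "a \<le> t" "t \<le> b" "\<bar>t - t0\<bar> \<le> real n * h"
  shows "norm (D t) \<le> 3 ^ n * (\<epsilon> + norm (D t0))"
  using t
proof (induction n arbitrary: t)
  case 0
  then show ?case using \<epsilon> by simp
next
  case (Suc n)
  \<comment> \<open>The predecessor of \<open>t\<close> on the way from \<open>t0\<close>.\<close>
  define r where "r = (if t0 \<le> t then max t0 (t - h) else min t0 (t + h))"
  have r: "a \<le> r" "r \<le> b" "\<bar>t - r\<bar> \<le> h" "\<bar>r - t0\<bar> \<le> real n * h"
    using Suc.prems t0 h by (auto simp: r_def algebra_simps max_def min_def abs_if split: if_splits)
  define N where "N = 3 ^ n * (\<epsilon> + norm (D t0))"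
  have "norm (D t) \<le> 2 * norm (D r) + \<epsilon>" using step[of r t] r Suc.prems by simp
  moreover have "norm (D r) \<le> N" using Suc.IH r by (simp add: N_def)
  moreover have "1 * (\<epsilon> + norm (D t0)) \<le> N"
    unfolding N_def using \<epsilon> by (intro mult_right_mono) auto
  ultimately have "norm (D t) \<le> 3 * N" using norm_ge_zero[of "D t0"] by argo
  thus ?case by (simp add: N_def)
qed

text \<open>The constant \<open>M\<close> depends on the data only through \<open>B\<close>, since the window length \<open>h\<close> is chosen
in terms of \<open>B\<close> alone. Increments over more than \<open>h\<close> are estimated by twice the supremum.\<close>

lemma germ_solution_stability:
  fixes a b \<gamma> \<theta> B :: real
  assumes \<gamma>: "1 / 2 < \<gamma>" and \<theta>: "0 < \<theta>" "\<theta> < 1" and \<rho>: "1 < (1 + \<theta>) * \<gamma>" and B: "1 \<le> B"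
  obtains M where "0 \<le> M"
    "\<And>(X :: real \<Rightarrow> 'u::real_normed_vector) X' (\<phi> :: 'v::real_normed_vector \<Rightarrow> 'u \<Rightarrow>\<^sub>L 'v) \<phi>' Y Y' K K' \<epsilon> t0 s t.
      increments_le \<gamma> B a b X \<Longrightarrow> increments_le \<gamma> B a b X' \<Longrightarrow> increments_le \<gamma> \<epsilon> a b (\<lambda>t. X t - X' t) \<Longrightarrow>
      lipschitz_bounded B \<phi> \<Longrightarrow> four_point_holder \<theta> B \<phi> \<Longrightarrow> lipschitz_bounded B \<phi>' \<Longrightarrow>
      lipschitz_bounded \<epsilon> (\<lambda>x. \<phi> x - \<phi>' x) \<Longrightarrow>
      germ_solution \<gamma> \<phi> X K a b Y \<Longrightarrow> germ_solution \<gamma> \<phi>' X' K' a b Y' \<Longrightarrow>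
      a \<le> t0 \<Longrightarrow> t0 \<le> b \<Longrightarrow> a \<le> s \<Longrightarrow> s \<le> t \<Longrightarrow> t \<le> b \<Longrightarrow>
      norm (Y t - Y' t) \<le> M * (\<epsilon> + norm (Y t0 - Y' t0)) \<and>
      norm ((Y t - Y' t) - (Y s - Y' s)) \<le> M * (\<epsilon> + norm (Y t0 - Y' t0)) * (t - s) powr \<gamma>"
proof -
  define c where "c = 1 - 2 powr (1 - 2 * \<gamma>)"
  define c' where "c' = 1 - 2 powr (1 - (1 + \<theta>) * \<gamma>)"
  define K1 where "K1 = 2 * B ^ 4 / c"
  define L where "L = B\<^sup>2 + K1"
  define G where "G = 2 * B\<^sup>2 + 2 * (2 * B ^ 4 + 2 * L * B\<^sup>2) / c'"
  have c: "0 < c" "0 < c'" using two_powr_gap[of "2 * \<gamma>"] two_powr_gap[OF \<rho>] \<gamma> by (auto simp: c_def c'_def)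
  have \<gamma>0: "0 < \<gamma>" using \<gamma> by simp
  have K1: "0 \<le> K1" using c by (simp add: K1_def)
  have L: "1 \<le> L" using B K1 one_le_power[OF B, of 2] unfolding L_def by linarith
  have G: "0 < G"
  proof -
    have "0 < 2 * B\<^sup>2" using B by simp
    moreover have "0 \<le> 2 * (2 * B ^ 4 + 2 * L * B\<^sup>2) / c'" using B L c by simp
    ultimately show ?thesis unfolding G_def by linarith
  qed
  have B2: "0 < B\<^sup>2" using B by simp
  \<comment> \<open>The three conditions are those of the a priori bound, of the difference estimate and of its propagation.\<close>
  define \<eta> where "\<eta> = min (min (c / (2 * B\<^sup>2)) (c' / (2 * B\<^sup>2))) (1 / (2 * G))"
  have \<eta>: "0 < \<eta>" using c B2 G by (simp add: \<eta>_def)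
  obtain h where h: "0 < h" "h \<le> 1" "h powr \<gamma> \<le> \<eta>" using exists_small_step[OF \<gamma>0 \<eta>] .
  have small: "B\<^sup>2 * h powr \<gamma> \<le> c / 2" "B\<^sup>2 * h powr \<gamma> \<le> c' / 2" "G * h powr \<gamma> \<le> 1 / 2"
    using h(3) B2 G by (auto simp: \<eta>_def field_simps)
  obtain n :: nat where n: "(b - a) / h \<le> real n" using real_arch_simple by blast
  define T :: real where "T = 3 ^ n"
  define M where "M = max T (max (G * (T + 1)) (2 * T / h powr \<gamma>))"
  have T: "1 \<le> T" by (simp add: T_def)
  show thesis
  proof
    show "0 \<le> M" using T by (simp add: M_def)
    fix X X' :: "real \<Rightarrow> 'u" and \<phi> \<phi>' :: "'v \<Rightarrow> 'u \<Rightarrow>\<^sub>L 'v" and Y Y' K K' \<epsilon> t0 s t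
    assume X: "increments_le \<gamma> B a b X" "increments_le \<gamma> B a b X'"
      and dX: "increments_le \<gamma> \<epsilon> a b (\<lambda>t. X t - X' t)"
      and \<phi>: "lipschitz_bounded B \<phi>" "four_point_holder \<theta> B \<phi>" and \<phi>': "lipschitz_bounded B \<phi>'"
      and d\<phi>: "lipschitz_bounded \<epsilon> (\<lambda>x. \<phi> x - \<phi>' x)"
      and Y: "germ_solution \<gamma> \<phi> X K a b Y" and Y': "germ_solution \<gamma> \<phi>' X' K' a b Y'"
      and t0: "a \<le> t0" "t0 \<le> b" and st: "a \<le> s" "s \<le> t" "t \<le> b"
    define D where "D t = Y t - Y' t" for t
    define \<epsilon>' where "\<epsilon>' = \<epsilon> + norm (D t0)"
    have \<epsilon>: "0 \<le> \<epsilon>" using lipschitz_boundedD(3)[OF d\<phi>] .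
    have \<epsilon>': "0 \<le> \<epsilon>'" "\<epsilon> \<le> \<epsilon>'" using \<epsilon> by (auto simp: \<epsilon>'_def)
    \<comment> \<open>Uniform a priori bounds first, so that the difference estimate applies with constants that depend on \<open>B\<close> alone.\<close>
    have window: "norm (D t - D s) \<le> G * (S + \<epsilon>) * (t - s) powr \<gamma>"
      if w: "a \<le> p" "q \<le> b" "q - p \<le> h" and S: "\<And>t. p \<le> t \<Longrightarrow> t \<le> q \<Longrightarrow> norm (D t) \<le> S"
        and st: "p \<le> s" "s \<le> t" "t \<le> q" for p q S s t
    proof -
      note X_w = increments_le_subinterval[OF X(1) w(1,2)] increments_le_subinterval[OF X(2) w(1,2)]
      have Y_w: "germ_solution \<gamma> \<phi> X K1 p q Y" "germ_solution \<gamma> \<phi>' X' K1 p q Y'"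
        using local_apriori_bound[OF \<gamma> X_w(1) \<phi>(1) germ_solution_subinterval[OF Y w(1,2)] w(3)]
          local_apriori_bound[OF \<gamma> X_w(2) \<phi>' germ_solution_subinterval[OF Y' w(1,2)] w(3)] small(1)
        by (auto simp: K1_def c_def)
      have "(q - p) powr \<gamma> \<le> 1 powr \<gamma>" using w h \<gamma>0 st by (intro powr_mono2) auto
      hence "B\<^sup>2 + K1 * (q - p) powr \<gamma> \<le> L" using K1 mult_left_mono[of "(q - p) powr \<gamma>" 1 K1] by (simp add: L_def)
      moreover have "increments_le \<gamma> (B\<^sup>2 + K1 * (q - p) powr \<gamma>) p q Y"
        "increments_le \<gamma> (B\<^sup>2 + K1 * (q - p) powr \<gamma>) p q Y'"
        using germ_solution_increments[OF _ X_w(1) \<phi>(1) Y_w(1) K1]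
          germ_solution_increments[OF _ X_w(2) \<phi>' Y_w(2) K1] \<gamma>0 by auto
      ultimately have inc: "increments_le \<gamma> L p q Y" "increments_le \<gamma> L p q Y'"
        unfolding increments_le_def by (meson mult_right_mono order_trans powr_ge_zero)+
      show ?thesis
        unfolding D_def G_def c'_def
        by (rule local_stability[OF \<gamma>0 \<theta> \<rho> B L X_w(1) increments_le_subinterval[OF dX w(1,2)] \<phi> \<phi>' d\<phi>
              inc(1) Y_w(1) inc(2) Y_w(2) K1 w(3) h(2) small(2)[unfolded c'_def] S[unfolded D_def] st])
    qed
    \<comment> \<open>The supremum of the distance has to be finite before it can be absorbed in \<open>local_propagation\<close>.\<close>
    have bounded: "\<exists>S0. \<forall>t. a \<le> t \<longrightarrow> t \<le> b \<longrightarrow> norm (D t) \<le> S0"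
    proof -
      have "norm (D t) \<le> norm (D a) + \<bar>B\<^sup>2 + max 0 K * (b - a) powr \<gamma>\<bar> * (b - a) powr \<gamma>
          + \<bar>B\<^sup>2 + max 0 K' * (b - a) powr \<gamma>\<bar> * (b - a) powr \<gamma>" if t: "a \<le> t" "t \<le> b" for t
      proof -
        have m: "germ_solution \<gamma> \<phi> X (max 0 K) a b Y" "germ_solution \<gamma> \<phi>' X' (max 0 K') a b Y'"
          using Y Y' unfolding germ_solution_def
          by (meson max.cobounded2 mult_right_mono order_trans powr_ge_zero)+
        have "norm (Y t - Y a) \<le> (B\<^sup>2 + max 0 K * (b - a) powr \<gamma>) * (t - a) powr \<gamma>"
          using germ_solution_increments[OF _ X(1) \<phi>(1) m(1)] \<gamma>0 t by (auto dest: increments_leD)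
        also have "\<dots> \<le> \<bar>B\<^sup>2 + max 0 K * (b - a) powr \<gamma>\<bar> * (b - a) powr \<gamma>"
          using t \<gamma>0 by (intro mult_mono powr_mono2) auto
        finally have 1: "norm (Y t - Y a) \<le> \<bar>B\<^sup>2 + max 0 K * (b - a) powr \<gamma>\<bar> * (b - a) powr \<gamma>" .
        have "norm (Y' t - Y' a) \<le> (B\<^sup>2 + max 0 K' * (b - a) powr \<gamma>) * (t - a) powr \<gamma>"
          using germ_solution_increments[OF _ X(2) \<phi>' m(2)] \<gamma>0 t by (auto dest: increments_leD)
        also have "\<dots> \<le> \<bar>B\<^sup>2 + max 0 K' * (b - a) powr \<gamma>\<bar> * (b - a) powr \<gamma>"
          using t \<gamma>0 by (intro mult_mono powr_mono2) auto
        finally have 2: "norm (Y' a - Y' t) \<le> \<bar>B\<^sup>2 + max 0 K' * (b - a) powr \<gamma>\<bar> * (b - a) powr \<gamma>"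
          by (simp add: norm_minus_commute)
        have "D t = D a + (Y t - Y a) + (Y' a - Y' t)" by (simp add: D_def)
        thus ?thesis using 1 2 by (simp only: norm_triangle_mono order_refl)
      qed
      thus ?thesis by blast
    qed
    have step: "norm (D v) \<le> 2 * norm (D r) + \<epsilon>"
      if rv: "a \<le> r" "r \<le> b" "a \<le> v" "v \<le> b" "\<bar>v - r\<bar> \<le> h" for r v
    proof -
      obtain S0 where S0: "\<And>t. a \<le> t \<Longrightarrow> t \<le> b \<Longrightarrow> norm (D t) \<le> S0" using bounded by blast
      define p q where "p = min r v" and "q = max r v"
      have w: "a \<le> p" "q \<le> b" "q - p \<le> h" using rv by (auto simp: p_def q_def)
      show ?thesis
        by (rule local_propagation[where p = p and q = q and G = G and h = h and \<gamma> = \<gamma> and ?S0.0 = S0])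
          (use window[OF w] S0 w small(3) G \<gamma>0 \<epsilon> in \<open>auto simp: p_def q_def\<close>)
    qed
    have sup: "norm (D v) \<le> T * \<epsilon>'" if v: "a \<le> v" "v \<le> b" for v
      unfolding T_def \<epsilon>'_def
    proof (rule chain_propagation[OF step h(1) \<epsilon> t0 v])
      have "\<bar>v - t0\<bar> \<le> b - a" using v t0 by auto
      also have "\<dots> \<le> real n * h" using n h by (simp add: pos_divide_le_eq)
      finally show "\<bar>v - t0\<bar> \<le> real n * h" .
    qed
    have "norm (D t - D s) \<le> M * \<epsilon>' * (t - s) powr \<gamma>"
    proof (cases "t - s \<le> h")
      case True
      have "norm (D t - D s) \<le> G * (T * \<epsilon>' + \<epsilon>) * (t - s) powr \<gamma>"
        using window[of s t "T * \<epsilon>'" s t] True st sup by simp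
      also have "G * (T * \<epsilon>' + \<epsilon>) \<le> G * (T * \<epsilon>' + \<epsilon>')" using G \<epsilon>' by simp
      also have "\<dots> = G * (T + 1) * \<epsilon>'" by (simp add: algebra_simps)
      also have "\<dots> \<le> M * \<epsilon>'" using \<epsilon>' by (intro mult_right_mono) (auto simp: M_def)
      finally show ?thesis by (simp add: mult_right_mono)
    next
      case False
      have "norm (D t - D s) \<le> T * \<epsilon>' + T * \<epsilon>'"
        using norm_triangle_ineq4[of "D t" "D s"] sup[of t] sup[of s] st by simp
      also have "\<dots> = 2 * T / h powr \<gamma> * \<epsilon>' * h powr \<gamma>" using h by simp
      also have "\<dots> \<le> M * \<epsilon>' * (t - s) powr \<gamma>"
        using \<epsilon>' h False T \<gamma>0 by (intro mult_mono powr_mono2) (auto simp: M_def)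
      finally show ?thesis .
    qed
    moreover have "norm (D t) \<le> M * \<epsilon>'"
      using sup[of t] st mult_right_mono[of T M \<epsilon>'] \<epsilon>' by (auto simp: M_def)
    ultimately show "norm (Y t - Y' t) \<le> M * (\<epsilon> + norm (Y t0 - Y' t0)) \<and>
      norm ((Y t - Y' t) - (Y s - Y' s)) \<le> M * (\<epsilon> + norm (Y t0 - Y' t0)) * (t - s) powr \<gamma>"
      by (simp add: D_def \<epsilon>'_def)
  qed
qed

section \<open>Hoelder seminorms and maps with Hoelder derivative\<close>

lemma holder_seminorm_nonneg:
  assumes "holder_bounded \<gamma> S f"
  shows "0 \<le> holder_seminorm \<gamma> S f"
  using assms unfolding holder_seminorm_def holder_bounded_def by (intro cSup_upper) auto

lemma holder_seminorm_bound:
  assumes "holder_bounded \<gamma> S f" "s \<in> S" "t \<in> S"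
  shows "norm (f t - f s) \<le> holder_seminorm \<gamma> S f * dist t s powr \<gamma>"
proof (cases "s = t")
  case False
  have "norm (f t - f s) / dist t s powr \<gamma> \<le> holder_seminorm \<gamma> S f"
    using assms False unfolding holder_seminorm_def holder_bounded_def by (intro cSup_upper) auto
  thus ?thesis using False by (simp add: pos_divide_le_eq)
qed simp

lemma holder_bounded_seminorm_le:
  assumes C: "0 \<le> C" and f: "\<And>s t. s \<in> S \<Longrightarrow> t \<in> S \<Longrightarrow> norm (f t - f s) \<le> C * dist t s powr \<gamma>"
  shows "holder_bounded \<gamma> S f" "holder_seminorm \<gamma> S f \<le> C"
proof -
  have *: "norm (f t - f s) / dist t s powr \<gamma> \<le> C" if "s \<in> S" "t \<in> S" "s \<noteq> t" for s t
    using f[OF that(1,2)] that(3) by (simp add: pos_divide_le_eq)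
  show "holder_bounded \<gamma> S f" unfolding holder_bounded_def using * by (auto intro!: bdd_aboveI[of _ C])
  show "holder_seminorm \<gamma> S f \<le> C"
    unfolding holder_seminorm_def using * C by (intro cSup_least) auto
qed

lemma holder_bounded_diff:
  assumes f: "holder_bounded \<gamma> S f" and g: "holder_bounded \<gamma> S g"
  shows "holder_bounded \<gamma> S (\<lambda>t. f t - g t)"
proof (rule holder_bounded_seminorm_le(1))
  show "0 \<le> holder_seminorm \<gamma> S f + holder_seminorm \<gamma> S g"
    using assms by (intro add_nonneg_nonneg holder_seminorm_nonneg)
  fix s t assume "s \<in> S" "t \<in> S"
  hence "norm (f t - f s) \<le> holder_seminorm \<gamma> S f * dist t s powr \<gamma>"
    "norm (g s - g t) \<le> holder_seminorm \<gamma> S g * dist t s powr \<gamma>"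
    using holder_seminorm_bound[OF f, of s t] holder_seminorm_bound[OF g, of s t]
    by (auto simp: norm_minus_commute)
  moreover have "(f t - g t) - (f s - g s) = (f t - f s) + (g s - g t)" by simp
  ultimately show "norm ((f t - g t) - (f s - g s))
      \<le> (holder_seminorm \<gamma> S f + holder_seminorm \<gamma> S g) * dist t s powr \<gamma>"
    by (simp only: distrib_right norm_triangle_mono)
qed

lemma increments_le_abs:
  assumes "increments_le \<gamma> B a b X" "s \<in> {a..b}" "t \<in> {a..b}"
  shows "norm (X t - X s) \<le> B * \<bar>t - s\<bar> powr \<gamma>"
proof (cases "s \<le> t")
  case True
  then show ?thesis using increments_leD[OF assms(1), of s t] assms(2,3) by simp
next
  case False
  then show ?thesis using increments_leD[OF assms(1), of t s] assms(2,3) by (simp add: norm_minus_commute)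
qed

lemma increments_le_imp_continuous_on:
  assumes \<gamma>: "0 < \<gamma>" and X: "increments_le \<gamma> B a b X"
  shows "continuous_on {a..b} X"
  unfolding continuous_on_iff
proof (intro ballI allI impI)
  fix s e :: real assume s: "s \<in> {a..b}" and e: "0 < e"
  have "0 < e / (\<bar>B\<bar> + 1)" using e by (simp add: add_nonneg_pos)
  then obtain h where h: "0 < h" "h powr \<gamma> \<le> e / (\<bar>B\<bar> + 1)"
    using exists_small_step[OF \<gamma>] by metis
  have "dist (X t) (X s) < e" if t: "t \<in> {a..b}" "dist t s < h" for t
  proof -
    have "norm (X t - X s) \<le> B * \<bar>t - s\<bar> powr \<gamma>" by (rule increments_le_abs[OF X s t(1)])
    also have "\<dots> \<le> \<bar>B\<bar> * h powr \<gamma>"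
      using t \<gamma> by (intro mult_mono powr_mono2) (auto simp: dist_real_def)
    also have "\<dots> < (\<bar>B\<bar> + 1) * h powr \<gamma>" using h by simp
    also have "\<dots> \<le> e" using h by (simp add: pos_le_divide_eq mult.commute add_nonneg_pos)
    finally show ?thesis by (simp add: dist_norm)
  qed
  thus "\<exists>d>0. \<forall>x'\<in>{a..b}. dist x' s < d \<longrightarrow> dist (X x') (X s) < e" using h by blast
qed

lemma increments_le_imp_holder:
  assumes X: "increments_le \<gamma> B a b X" and B: "0 \<le> B"
  shows "holder_bounded \<gamma> {a..b} X" "holder_seminorm \<gamma> {a..b} X \<le> B"
  using holder_bounded_seminorm_le[OF B, of "{a..b}" X \<gamma>] increments_le_abs[OF X]
  by (auto simp: dist_real_def)

lemma holder_bounded_imp_increments_le: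
  assumes "holder_bounded \<gamma> {a..b} X" "holder_seminorm \<gamma> {a..b} X \<le> B"
  shows "increments_le \<gamma> B a b X"
  unfolding increments_le_def
proof (intro allI impI)
  fix s t assume st: "a \<le> s" "s \<le> t" "t \<le> b"
  have "norm (X t - X s) \<le> holder_seminorm \<gamma> {a..b} X * (t - s) powr \<gamma>"
    using holder_seminorm_bound[OF assms(1), of s t] st by (simp add: dist_real_def)
  also have "\<dots> \<le> B * (t - s) powr \<gamma>" using assms(2) by (intro mult_right_mono) auto
  finally show "norm (X t - X s) \<le> B * (t - s) powr \<gamma>" .
qed

lemma holder_space_increments_le:
  assumes "X \<in> holder_space \<gamma> {a..b}" "holder_seminorm \<gamma> {a..b} X \<le> B"
  shows "increments_le \<gamma> B a b X"
  using assms by (intro holder_bounded_imp_increments_le) (auto simp: holder_space_def)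

lemma has_derivative_fderiv:
  assumes "\<phi> differentiable (at x)"
  shows "(\<phi> has_derivative blinfun_apply (fderiv \<phi> x)) (at x)"
  using assms unfolding fderiv_def
  by (simp add: bounded_linear_Blinfun_apply has_derivative_bounded_linear frechet_derivative_works)

lemma fderiv_eqI:
  assumes "(\<phi> has_derivative blinfun_apply D) (at x)"
  shows "fderiv \<phi> x = D"
  unfolding fderiv_def using frechet_derivative_at[OF assms] by (metis blinfun_apply_inverse)

lemma C1_holder_diff:
  assumes \<phi>: "\<phi> \<in> C1_holder \<theta>" and \<psi>: "\<psi> \<in> C1_holder \<theta>"
  shows "(\<lambda>x. \<phi> x - \<psi> x) \<in> C1_holder \<theta>"
proof -
  have diff: "(\<lambda>x. \<phi> x - \<psi> x) differentiable (at x)" for x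
    using \<phi> \<psi> by (auto simp: C1_holder_def)
  have D: "fderiv (\<lambda>x. \<phi> x - \<psi> x) = (\<lambda>x. fderiv \<phi> x - fderiv \<psi> x)"
  proof
    fix x
    have "(\<phi> has_derivative blinfun_apply (fderiv \<phi> x)) (at x)" "(\<psi> has_derivative blinfun_apply (fderiv \<psi> x)) (at x)"
      using \<phi> \<psi> by (auto simp: C1_holder_def intro!: has_derivative_fderiv)
    from has_derivative_diff[OF this] show "fderiv (\<lambda>x. \<phi> x - \<psi> x) x = fderiv \<phi> x - fderiv \<psi> x"
      by (intro fderiv_eqI) (simp add: blinfun.diff_left[abs_def] minus_blinfun.rep_eq)
  qed
  have bdd: "bdd_above (range (\<lambda>x. norm (f x - g x)))"
    if f: "bdd_above (range (\<lambda>x. norm (f x)))" and g: "bdd_above (range (\<lambda>x. norm (g x)))"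
    for f g :: "'a \<Rightarrow> 'c::real_normed_vector"
  proof -
    obtain M N where "\<And>x. norm (f x) \<le> M" "\<And>x. norm (g x) \<le> N"
      using f g by (auto simp: bdd_above_def)
    hence "norm (f x - g x) \<le> M + N" for x by (meson add_mono norm_triangle_ineq4 order_trans)
    thus ?thesis by (intro bdd_aboveI2)
  qed
  show ?thesis
    using \<phi> \<psi> diff bdd[of \<phi> \<psi>] bdd[of "fderiv \<phi>" "fderiv \<psi>"]
      holder_bounded_diff[of \<theta> UNIV "fderiv \<phi>" "fderiv \<psi>"]
    by (auto simp: C1_holder_def D)
qed

lemma C1_holder_norm_bounds:
  assumes \<phi>: "\<phi> \<in> C1_holder \<theta>" and B: "C1_holder_norm \<theta> \<phi> \<le> B"
  shows "norm (\<phi> x) \<le> B" "norm (fderiv \<phi> x) \<le> B"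
    "norm (fderiv \<phi> x - fderiv \<phi> z) \<le> B * norm (x - z) powr \<theta>"
proof -
  have 1: "norm (\<phi> x) \<le> (SUP x. norm (\<phi> x))" and 2: "norm (fderiv \<phi> x) \<le> (SUP x. norm (fderiv \<phi> x))" for x
    using \<phi> by (auto simp: C1_holder_def intro!: cSUP_upper)
  have h: "holder_bounded \<theta> UNIV (fderiv \<phi>)" using \<phi> by (simp add: C1_holder_def)
  note 3 = holder_seminorm_nonneg[OF h]
  show "norm (\<phi> x) \<le> B" "norm (fderiv \<phi> x) \<le> B"
    using 1[of x] 2[of x] 3 norm_ge_zero[of "\<phi> x"] norm_ge_zero[of "fderiv \<phi> x"] B
    unfolding C1_holder_norm_def by linarith+
  have "norm (fderiv \<phi> x - fderiv \<phi> z) \<le> holder_seminorm \<theta> UNIV (fderiv \<phi>) * norm (x - z) powr \<theta>"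
    using holder_seminorm_bound[OF h, of z x] by (simp add: dist_norm)
  also have "\<dots> \<le> B * norm (x - z) powr \<theta>"
    using 1[of x] 2[of x] norm_ge_zero[of "\<phi> x"] norm_ge_zero[of "fderiv \<phi> x"] B
    unfolding C1_holder_norm_def by (intro mult_right_mono) (linarith, simp)
  finally show "norm (fderiv \<phi> x - fderiv \<phi> z) \<le> B * norm (x - z) powr \<theta>" .
qed

lemma C1_holder_lipschitz_bounded:
  assumes \<phi>: "\<phi> \<in> C1_holder \<theta>" and B: "C1_holder_norm \<theta> \<phi> \<le> B"
  shows "lipschitz_bounded B \<phi>"
proof -
  have "norm (\<phi> x - \<phi> z) \<le> B * norm (x - z)" for x z
  proof (rule differentiable_bound[OF convex_UNIV])
    show "(\<phi> has_derivative blinfun_apply (fderiv \<phi> x)) (at x)" for x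
      using \<phi> by (intro has_derivative_fderiv) (simp add: C1_holder_def)
    show "onorm (blinfun_apply (fderiv \<phi> x)) \<le> B" for x
      using C1_holder_norm_bounds(2)[OF assms] by (simp add: norm_blinfun.rep_eq)
  qed auto
  thus ?thesis using C1_holder_norm_bounds(1)[OF assms] by (auto simp: lipschitz_bounded_def)
qed

text \<open>Apply the mean value theorem to \<open>\<phi>\<close> along the segment from \<open>z\<close> to \<open>x\<close> minus \<open>\<phi>\<close>
along the segment from \<open>z'\<close> to \<open>x'\<close>, traversed simultaneously. The two points stay within
\<open>norm (x - x') + norm (z - z')\<close> of each other.\<close>

lemma C1_holder_four_point:
  fixes \<phi> :: "'v::real_normed_vector \<Rightarrow> 'w::real_normed_vector"
  assumes \<theta>: "0 \<le> \<theta>" and \<phi>: "\<phi> \<in> C1_holder \<theta>" and B: "C1_holder_norm \<theta> \<phi> \<le> B"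
  shows "four_point_holder \<theta> B \<phi>"
  unfolding four_point_holder_def
proof (intro allI)
  fix x x' z z' :: 'v
  define N where "N = B * norm (x - x' - z + z') + B * (norm (x - x') + norm (z - z')) powr \<theta> * norm (x' - z')"
  define P where "P \<tau> = z + \<tau> *\<^sub>R (x - z)" for \<tau> :: real
  define Q where "Q \<tau> = z' + \<tau> *\<^sub>R (x' - z')" for \<tau> :: real
  define g where "g \<tau> = \<phi> (P \<tau>) - \<phi> (Q \<tau>)" for \<tau> :: real
  define g' where "g' \<tau> \<sigma> = \<sigma> *\<^sub>R (blinfun_apply (fderiv \<phi> (P \<tau>)) (x - z) - blinfun_apply (fderiv \<phi> (Q \<tau>)) (x' - z'))"
    for \<tau> \<sigma> :: real
  note bounds = C1_holder_norm_bounds[OF \<phi> B]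
  have B0: "0 \<le> B" using bounds(1)[of 0] norm_ge_zero order_trans by blast
  have d\<phi>: "(\<phi> has_derivative blinfun_apply (fderiv \<phi> x)) (at x)" for x
    using \<phi> by (intro has_derivative_fderiv) (simp add: C1_holder_def)
  have "norm (g 1 - g 0) \<le> N * norm (1 - 0 :: real)"
  proof (rule differentiable_bound[of "{0..1::real}"])
    fix \<tau> :: real assume \<tau>: "\<tau> \<in> {0..1}"
    have "((\<lambda>\<tau>. \<phi> (P \<tau>)) has_derivative (\<lambda>\<sigma>. blinfun_apply (fderiv \<phi> (P \<tau>)) (\<sigma> *\<^sub>R (x - z)))) (at \<tau>)"
      by (rule has_derivative_compose[OF _ d\<phi>]) (auto simp: P_def intro!: derivative_eq_intros)
    moreover have "((\<lambda>\<tau>. \<phi> (Q \<tau>)) has_derivative (\<lambda>\<sigma>. blinfun_apply (fderiv \<phi> (Q \<tau>)) (\<sigma> *\<^sub>R (x' - z')))) (at \<tau>)"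
      by (rule has_derivative_compose[OF _ d\<phi>]) (auto simp: Q_def intro!: derivative_eq_intros)
    ultimately have "(g has_derivative g' \<tau>) (at \<tau>)"
      unfolding g_def[abs_def] g'_def[abs_def]
      by (auto dest: has_derivative_diff simp: blinfun.bilinear_simps scaleR_diff_right)
    thus "(g has_derivative g' \<tau>) (at \<tau> within {0..1})" by (rule has_derivative_at_withinI)
    show "onorm (g' \<tau>) \<le> N"
    proof (rule onorm_le)
      fix \<sigma> :: real
      have PQ: "norm (P \<tau> - Q \<tau>) \<le> norm (x - x') + norm (z - z')"
      proof -
        have "P \<tau> - Q \<tau> = \<tau> *\<^sub>R (x - x') + (1 - \<tau>) *\<^sub>R (z - z')"
          by (simp add: P_def Q_def algebra_simps)
        hence "norm (P \<tau> - Q \<tau>) \<le> \<tau> * norm (x - x') + (1 - \<tau>) * norm (z - z')"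
          using \<tau> norm_triangle_ineq[of "\<tau> *\<^sub>R (x - x')" "(1 - \<tau>) *\<^sub>R (z - z')"] by simp
        also have "\<dots> \<le> 1 * norm (x - x') + 1 * norm (z - z')"
          using \<tau> by (intro add_mono mult_right_mono) auto
        finally show ?thesis by simp
      qed
      have "norm (fderiv \<phi> (P \<tau>) - fderiv \<phi> (Q \<tau>)) \<le> B * norm (P \<tau> - Q \<tau>) powr \<theta>" by (rule bounds(3))
      also have "\<dots> \<le> B * (norm (x - x') + norm (z - z')) powr \<theta>"
        using PQ \<theta> B0 by (intro mult_left_mono powr_mono2) auto
      finally have D: "norm (fderiv \<phi> (P \<tau>) - fderiv \<phi> (Q \<tau>)) \<le> B * (norm (x - x') + norm (z - z')) powr \<theta>" .
      have "blinfun_apply (fderiv \<phi> (P \<tau>)) (x - z) - blinfun_apply (fderiv \<phi> (Q \<tau>)) (x' - z')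
          = blinfun_apply (fderiv \<phi> (P \<tau>)) (x - x' - z + z')
            + blinfun_apply (fderiv \<phi> (P \<tau>) - fderiv \<phi> (Q \<tau>)) (x' - z')"
        by (simp add: blinfun.bilinear_simps algebra_simps)
      moreover have "norm (blinfun_apply (fderiv \<phi> (P \<tau>)) (x - x' - z + z')) \<le> B * norm (x - x' - z + z')"
        by (rule blinfun_apply_le[OF bounds(2) order_refl])
      moreover have "norm (blinfun_apply (fderiv \<phi> (P \<tau>) - fderiv \<phi> (Q \<tau>)) (x' - z'))
          \<le> B * (norm (x - x') + norm (z - z')) powr \<theta> * norm (x' - z')"
        by (rule blinfun_apply_le[OF D order_refl])
      ultimately have "norm (blinfun_apply (fderiv \<phi> (P \<tau>)) (x - z) - blinfun_apply (fderiv \<phi> (Q \<tau>)) (x' - z')) \<le> N"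
        unfolding N_def by (simp only: norm_triangle_mono)
      thus "norm (g' \<tau> \<sigma>) \<le> N * norm \<sigma>"
        by (simp add: g'_def mult.commute[of N] mult_left_mono)
    qed
  qed auto
  moreover have "g 1 - g 0 = \<phi> x - \<phi> x' - \<phi> z + \<phi> z'" by (simp add: g_def P_def Q_def)
  ultimately show "norm (\<phi> x - \<phi> x' - \<phi> z + \<phi> z')
      \<le> B * norm (x - x' - z + z') + B * (norm (x - x') + norm (z - z')) powr \<theta> * norm (x' - z')"
    by (simp add: N_def)
qed

section \<open>The Young integral\<close>

text \<open>The increments of \<open>E\<close> have no defect at all, so \<open>defect_absorption\<close> applies with
\<open>C = 0\<close>.\<close>

lemma superlinear_increments_const:
  fixes E :: "real \<Rightarrow> 'v::real_normed_vector"
  assumes \<rho>: "1 < \<rho>" and E: "\<And>s t. a \<le> s \<Longrightarrow> s \<le> t \<Longrightarrow> t \<le> b \<Longrightarrow> norm (E t - E s) \<le> M * (t - s) powr \<rho>"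
    and st: "s \<in> {a..b}" "t \<in> {a..b}"
  shows "E s = E t"
proof -
  have *: "E s = E t" if "a \<le> s" "s \<le> t" "t \<le> b" for s t
  proof -
    have "norm (E t - E s) \<le> 0 / (1 - 0 - 2 powr (1 - \<rho>)) * (t - s) powr \<rho>"
      by (rule defect_absorption[where R = "\<lambda>s t. E t - E s" and N = M and p = a and q = b, OF _ _ _ E _ that])
        (use two_powr_gap[OF \<rho>] in auto)
    thus ?thesis by simp
  qed
  show ?thesis using * st by (metis atLeastAtMost_iff linear)
qed

text \<open>A trajectory \<open>I\<close> of the almost flow \<open>F s * (G t - G s)\<close>, which does not depend on the state, is an
indefinite Young integral, and the remainder is read off from its increments.\<close>

lemma young_remainder_exists:
  fixes F G :: "real \<Rightarrow> real"
  assumes \<gamma>: "1 / 2 < \<gamma>" and F: "increments_le \<gamma> B a b F" and G: "increments_le \<gamma> C a b G"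
    and BC: "0 \<le> B" "0 \<le> C" and ab: "a \<le> b"
  obtains R where "young_remainder \<gamma> \<gamma> {a..b} F G R"
proof -
  have \<gamma>0: "0 < \<gamma>" using \<gamma> by simp
  define A where "A s t y = F s * (G t - G s)" for s t y :: real
  obtain I K where I: "\<And>s t. a \<le> s \<Longrightarrow> s \<le> t \<Longrightarrow> t \<le> b \<Longrightarrow>
      norm (I t - I s - A s t (I s)) \<le> K * (t - s) powr (2 * \<gamma>)"
  proof (rule almost_flow_trajectory[where A = A and C = "B * C" and \<kappa> = 0 and \<rho> = "2 * \<gamma>" and a = a and b = b])
    show "continuous_on UNIV (A s t)" for s t by (simp add: A_def)
    fix s u t y z :: real assume st: "a \<le> s" "s \<le> u" "u \<le> t" "t \<le> b"
    have "A u t z + A s u y - A s t y = (F u - F s) * (G t - G u)" by (simp add: A_def algebra_simps)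
    hence "norm (A u t z + A s u y - A s t y) \<le> (B * (u - s) powr \<gamma>) * (C * (t - u) powr \<gamma>)"
      using increments_leD[OF F, of s u] increments_leD[OF G, of u t] st BC
      by (simp add: abs_mult mult_mono)
    also have "\<dots> = B * C * ((u - s) powr \<gamma> * (t - u) powr \<gamma>)" by simp
    also have "\<dots> \<le> B * C * (t - s) powr (2 * \<gamma>)"
      using powr_split_le[of s u t \<gamma> \<gamma>] st \<gamma>0 BC by (intro mult_left_mono) auto
    finally show "norm (A u t z + A s u y - A s t y)
        \<le> B * C * (t - s) powr (2 * \<gamma>) + 0 * norm (z - y - A s u y)" by simp
  qed (use BC \<gamma>0 ab two_powr_gap[of "2 * \<gamma>"] \<gamma> in \<open>auto simp: A_def\<close>)
  define R where "R s t = F s * (G t - G s) - (I t - I s)" for s t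
  have forward: "\<bar>R s t\<bar> \<le> K * (t - s) powr (2 * \<gamma>)" if "a \<le> s" "s \<le> t" "t \<le> b" for s t
    using I[OF that] by (simp add: R_def A_def abs_minus_commute)
  have bound: "\<bar>R s t\<bar> \<le> (\<bar>K\<bar> + B * C) * \<bar>t - s\<bar> powr (2 * \<gamma>)" if st: "s \<in> {a..b}" "t \<in> {a..b}" for s t
  proof (cases "s \<le> t")
    case True
    hence "\<bar>R s t\<bar> \<le> K * (t - s) powr (2 * \<gamma>)" using forward st by auto
    also have "\<dots> \<le> (\<bar>K\<bar> + B * C) * (t - s) powr (2 * \<gamma>)"
      using mult_nonneg_nonneg[OF BC] by (intro mult_right_mono) auto
    finally show ?thesis using True by simp
  next
    case False
    have "R s t = (F s - F t) * (G t - G s) - R t s" by (simp add: R_def algebra_simps)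
    hence "\<bar>R s t\<bar> \<le> \<bar>F s - F t\<bar> * \<bar>G t - G s\<bar> + \<bar>R t s\<bar>"
      by (simp add: abs_mult[symmetric] abs_triangle_ineq4)
    also have "\<dots> \<le> (B * \<bar>t - s\<bar> powr \<gamma>) * (C * \<bar>t - s\<bar> powr \<gamma>) + \<bar>K\<bar> * \<bar>t - s\<bar> powr (2 * \<gamma>)"
    proof (intro add_mono mult_mono)
      show "\<bar>F s - F t\<bar> \<le> B * \<bar>t - s\<bar> powr \<gamma>" "\<bar>G t - G s\<bar> \<le> C * \<bar>t - s\<bar> powr \<gamma>"
        using increments_le_abs[OF F st(2,1)] increments_le_abs[OF G st] by (simp_all add: abs_minus_commute)
      have "\<bar>R t s\<bar> \<le> K * (s - t) powr (2 * \<gamma>)" using forward[of t s] False st by auto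
      also have "\<dots> \<le> \<bar>K\<bar> * \<bar>t - s\<bar> powr (2 * \<gamma>)"
        using False by (intro mult_mono) (auto simp: abs_minus_commute)
      finally show "\<bar>R t s\<bar> \<le> \<bar>K\<bar> * \<bar>t - s\<bar> powr (2 * \<gamma>)" .
    qed (use BC in auto)
    also have "\<dots> = (\<bar>K\<bar> + B * C) * \<bar>t - s\<bar> powr (2 * \<gamma>)" by (simp add: algebra_simps flip: powr_add)
    finally show ?thesis .
  qed
  have "increments_le \<gamma> ((\<bar>F a\<bar> + B * (b - a) powr \<gamma>) * C + \<bar>K\<bar> * (b - a) powr \<gamma>) a b I"
    unfolding increments_le_def
  proof (intro allI impI)
    fix s t assume st: "a \<le> s" "s \<le> t" "t \<le> b"
    have "B * (s - a) powr \<gamma> \<le> B * (b - a) powr \<gamma>"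
      using st \<gamma>0 BC by (intro mult_left_mono powr_mono2) auto
    hence F_le: "\<bar>F s\<bar> \<le> \<bar>F a\<bar> + B * (b - a) powr \<gamma>"
      using increments_leD[OF F, of a s] st by auto
    have "\<bar>R s t\<bar> \<le> K * (t - s) powr (2 * \<gamma>)" by (rule forward[OF st])
    also have "\<dots> \<le> \<bar>K\<bar> * ((b - a) powr \<gamma> * (t - s) powr \<gamma>)"
    proof (rule mult_mono)
      have "(t - s) powr (2 * \<gamma>) = (t - s) powr \<gamma> * (t - s) powr \<gamma>" by (simp flip: powr_add)
      also have "\<dots> \<le> (b - a) powr \<gamma> * (t - s) powr \<gamma>"
        using st \<gamma>0 by (intro mult_right_mono powr_mono2) auto
      finally show "(t - s) powr (2 * \<gamma>) \<le> (b - a) powr \<gamma> * (t - s) powr \<gamma>" .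
    qed auto
    finally have R_le: "norm (- R s t) \<le> \<bar>K\<bar> * ((b - a) powr \<gamma> * (t - s) powr \<gamma>)" by simp
    have "norm (F s * (G t - G s)) \<le> (\<bar>F a\<bar> + B * (b - a) powr \<gamma>) * (C * (t - s) powr \<gamma>)"
      using F_le increments_leD[OF G st] BC by (simp add: abs_mult mult_mono)
    from norm_triangle_mono[OF this R_le]
    show "norm (I t - I s)
        \<le> ((\<bar>F a\<bar> + B * (b - a) powr \<gamma>) * C + \<bar>K\<bar> * (b - a) powr \<gamma>) * (t - s) powr \<gamma>"
      by (simp add: R_def algebra_simps)
  qed
  hence cont_I: "continuous_on {a..b} I" by (rule increments_le_imp_continuous_on[OF \<gamma>0])
  have "continuous_on ({a..b} \<times> {a..b}) (\<lambda>(s, t). R s t)"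
  proof -
    have cont: "continuous_on ({a..b} \<times> {a..b}) (\<lambda>x. f (fst x))" "continuous_on ({a..b} \<times> {a..b}) (\<lambda>x. f (snd x))"
      if "continuous_on {a..b} f" for f :: "real \<Rightarrow> real"
      by (rule continuous_on_compose2[OF that continuous_on_fst[OF continuous_on_id]], auto)
        (rule continuous_on_compose2[OF that continuous_on_snd[OF continuous_on_id]], auto)
    show ?thesis
      unfolding R_def case_prod_unfold
      by (intro continuous_intros cont cont_I increments_le_imp_continuous_on[OF \<gamma>0 F]
          increments_le_imp_continuous_on[OF \<gamma>0 G])
  qed
  moreover have "\<exists>M. \<forall>s\<in>{a..b}. \<forall>t\<in>{a..b}. \<bar>R s t\<bar> \<le> M * \<bar>t - s\<bar> powr (\<gamma> + \<gamma>)"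
    using bound unfolding mult_2 by blast
  moreover have "R s t - R u t - R s u = - (F u - F s) * (G t - G u)" for s u t
    by (simp add: R_def algebra_simps)
  ultimately have "young_remainder \<gamma> \<gamma> {a..b} F G R"
    unfolding young_remainder_def by blast
  thus thesis by (rule that)
qed

text \<open>The difference of two remainders is additive and superlinear.\<close>

lemma young_remainder_unique:
  assumes \<gamma>: "1 / 2 < \<gamma>" and R: "young_remainder \<gamma> \<gamma> {a..b} F G R" and R': "young_remainder \<gamma> \<gamma> {a..b} F G R'"
    and st: "s \<in> {a..b}" "t \<in> {a..b}"
  shows "R s t = R' s t"
proof -
  define E where "E t = R s t - R' s t" for t
  obtain M M' where M: "\<And>s t. s \<in> {a..b} \<Longrightarrow> t \<in> {a..b} \<Longrightarrow> \<bar>R s t\<bar> \<le> M * \<bar>t - s\<bar> powr (\<gamma> + \<gamma>)"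
    and M': "\<And>s t. s \<in> {a..b} \<Longrightarrow> t \<in> {a..b} \<Longrightarrow> \<bar>R' s t\<bar> \<le> M' * \<bar>t - s\<bar> powr (\<gamma> + \<gamma>)"
    using R R' unfolding young_remainder_def by metis
  have E_increment: "E v - E u = R u v - R' u v" if "u \<in> {a..b}" "v \<in> {a..b}" for u v
  proof -
    have "R s v - R u v - R s u = R' s v - R' u v - R' s u"
      using R R' st that by (simp add: young_remainder_def)
    thus ?thesis by (simp add: E_def)
  qed
  have "E s = E t"
  proof (rule superlinear_increments_const[where E = E and \<rho> = "\<gamma> + \<gamma>" and M = "M + M'" and a = a and b = b])
    fix u v assume uv: "a \<le> u" "u \<le> v" "v \<le> b"
    hence "\<bar>R u v - R' u v\<bar> \<le> M * \<bar>v - u\<bar> powr (\<gamma> + \<gamma>) + M' * \<bar>v - u\<bar> powr (\<gamma> + \<gamma>)"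
      using M[of u v] M'[of u v] abs_triangle_ineq4[of "R u v" "R' u v"] by auto
    thus "norm (E v - E u) \<le> (M + M') * (v - u) powr (\<gamma> + \<gamma>)"
      using E_increment[of u v] uv by (simp add: distrib_right)
  qed (use \<gamma> st in simp_all)
  moreover have "E s = 0" using M[OF st(1) st(1)] M'[OF st(1) st(1)] by (simp add: E_def)
  ultimately show ?thesis by (simp add: E_def)
qed

lemma young_integral_eq:
  assumes \<gamma>: "1 / 2 < \<gamma>" and R: "young_remainder \<gamma> \<gamma> {a..b} F G R" and st: "s \<in> {a..b}" "t \<in> {a..b}"
  shows "young_integral \<gamma> \<gamma> {a..b} F G s t = F s * (G t - G s) - R s t"
proof -
  have "(THE r. \<exists>R. young_remainder \<gamma> \<gamma> {a..b} F G R \<and> r = R s t) = R s t"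
    using R young_remainder_unique[OF \<gamma> _ R st] by (intro the_equality) blast+
  thus ?thesis by (simp add: young_integral_def)
qed

lemma young_integral_increment:
  assumes \<gamma>: "1 / 2 < \<gamma>" and R: "young_remainder \<gamma> \<gamma> {a..b} F G R"
    and "t0 \<in> {a..b}" "s \<in> {a..b}" "t \<in> {a..b}"
  shows "young_integral \<gamma> \<gamma> {a..b} F G t0 t - young_integral \<gamma> \<gamma> {a..b} F G t0 s = F s * (G t - G s) - R s t"
proof -
  have "R t0 t - R s t - R t0 s = - (F s - F t0) * (G t - G s)"
    using R assms(3-5) by (simp add: young_remainder_def)
  thus ?thesis using assms(3-5) by (simp add: young_integral_eq[OF \<gamma> R] algebra_simps)
qed

lemma young_integral_refl:
  assumes \<gamma>: "1 / 2 < \<gamma>" and R: "young_remainder \<gamma> \<gamma> {a..b} F G R" and s: "s \<in> {a..b}"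
  shows "young_integral \<gamma> \<gamma> {a..b} F G s s = 0"
proof -
  have "R s s - R s s - R s s = - (F s - F s) * (G s - G s)"
    using R s unfolding young_remainder_def by blast
  thus ?thesis by (simp add: young_integral_eq[OF \<gamma> R s s])
qed

section \<open>Young equations\<close>

lemma lipschitz_increments_component:
  fixes \<phi> :: "'v::euclidean_space \<Rightarrow> 'v \<Rightarrow>\<^sub>L 'v"
  assumes \<phi>: "lipschitz_bounded B \<phi>" and Y: "increments_le \<gamma> L a b Y" and ij: "i \<in> Basis" "j \<in> Basis"
  shows "increments_le \<gamma> (B * L) a b (\<lambda>u. blinfun_apply (\<phi> (Y u)) j \<bullet> i)"
  unfolding increments_le_def
proof (intro allI impI)
  fix s t assume st: "a \<le> s" "s \<le> t" "t \<le> b"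
  have "\<bar>blinfun_apply (\<phi> (Y t) - \<phi> (Y s)) j \<bullet> i\<bar> \<le> norm (blinfun_apply (\<phi> (Y t) - \<phi> (Y s)) j)"
    using Cauchy_Schwarz_ineq2[of "blinfun_apply (\<phi> (Y t) - \<phi> (Y s)) j" i] ij by simp
  also have "\<dots> \<le> norm (\<phi> (Y t) - \<phi> (Y s))"
    using norm_blinfun[of "\<phi> (Y t) - \<phi> (Y s)" j] ij by simp
  also have "\<dots> \<le> B * (L * (t - s) powr \<gamma>)"
    by (rule order_trans[OF lipschitz_boundedD(2)[OF \<phi>]
          mult_left_mono[OF increments_leD[OF Y st] lipschitz_boundedD(3)[OF \<phi>]]])
  finally show "norm (blinfun_apply (\<phi> (Y t)) j \<bullet> i - blinfun_apply (\<phi> (Y s)) j \<bullet> i) \<le> B * L * (t - s) powr \<gamma>"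
    by (simp add: blinfun.diff_left inner_diff_left mult.assoc)
qed

lemma increments_component:
  fixes X :: "real \<Rightarrow> 'v::euclidean_space"
  assumes X: "increments_le \<gamma> B a b X" and j: "j \<in> Basis"
  shows "increments_le \<gamma> B a b (\<lambda>u. X u \<bullet> j)"
  unfolding increments_le_def
proof (intro allI impI)
  fix s t assume st: "a \<le> s" "s \<le> t" "t \<le> b"
  have "norm (X t \<bullet> j - X s \<bullet> j) \<le> norm (X t - X s)"
    using Basis_le_norm[OF j, of "X t - X s"] by (simp add: inner_diff_left)
  thus "norm (X t \<bullet> j - X s \<bullet> j) \<le> B * (t - s) powr \<gamma>" using increments_leD[OF X st] by simp
qed

lemma blinfun_apply_inner_expansion:
  fixes f :: "'v::euclidean_space \<Rightarrow>\<^sub>L 'w::real_inner"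
  shows "blinfun_apply f x \<bullet> i = (\<Sum>j\<in>Basis. (blinfun_apply f j \<bullet> i) * (x \<bullet> j))"
proof -
  have "blinfun_apply f x = blinfun_apply f (\<Sum>j\<in>Basis. (x \<bullet> j) *\<^sub>R j)"
    by (simp add: euclidean_representation)
  also have "\<dots> = (\<Sum>j\<in>Basis. (x \<bullet> j) *\<^sub>R blinfun_apply f j)"
    by (simp add: blinfun.sum_right blinfun.scaleR_right)
  finally show ?thesis by (simp add: inner_sum_left mult.commute)
qed

text \<open>The components of the integral \<open>\<integral> \<phi>(Y) dX\<close> have the same increments as the Euler scheme, up to the sum
of the remainders.\<close>

lemma young_integral_sum_increment:
  fixes X Y :: "real \<Rightarrow> 'v::euclidean_space" and \<phi> :: "'v \<Rightarrow> 'v \<Rightarrow>\<^sub>L 'v"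
  assumes \<gamma>: "1 / 2 < \<gamma>" and \<phi>: "lipschitz_bounded B \<phi>" and X: "increments_le \<gamma> C a b X" "0 \<le> C"
    and Y: "increments_le \<gamma> L a b Y" "0 \<le> L" and t0: "t0 \<in> {a..b}" and i: "i \<in> Basis"
  defines "I \<equiv> \<lambda>t. \<Sum>j\<in>Basis.
      young_integral \<gamma> \<gamma> {a..b} (\<lambda>u. blinfun_apply (\<phi> (Y u)) j \<bullet> i) (\<lambda>u. X u \<bullet> j) t0 t"
  shows "I t0 = 0"
    and "\<exists>M. \<forall>s t. a \<le> s \<longrightarrow> s \<le> t \<longrightarrow> t \<le> b \<longrightarrow>
      \<bar>I t - I s - blinfun_apply (\<phi> (Y s)) (X t - X s) \<bullet> i\<bar> \<le> M * (t - s) powr (2 * \<gamma>)"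
proof -
  define F where "F j u = blinfun_apply (\<phi> (Y u)) j \<bullet> i" for j u
  define G where "G j u = X u \<bullet> j" for j u
  have ab: "a \<le> b" using t0 by simp
  have "\<exists>R. young_remainder \<gamma> \<gamma> {a..b} (F j) (G j) R" if j: "j \<in> Basis" for j
  proof -
    have "increments_le \<gamma> (B * L) a b (F j)" "increments_le \<gamma> C a b (G j)"
      unfolding F_def[abs_def] G_def[abs_def]
      by (rule lipschitz_increments_component[OF \<phi> Y(1) i j]) (rule increments_component[OF X(1) j])
    thus ?thesis
      using young_remainder_exists[OF \<gamma> _ _ _ X(2) ab] lipschitz_boundedD(3)[OF \<phi>] Y(2)
      by (metis mult_nonneg_nonneg)
  qed
  then obtain R where R: "\<And>j. j \<in> Basis \<Longrightarrow> young_remainder \<gamma> \<gamma> {a..b} (F j) (G j) (R j)" by metis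
  have I: "I t = (\<Sum>j\<in>Basis. young_integral \<gamma> \<gamma> {a..b} (F j) (G j) t0 t)" for t
    by (simp add: I_def F_def[abs_def] G_def[abs_def])
  show "I t0 = 0" unfolding I using young_integral_refl[OF \<gamma> R t0] by simp
  have "\<exists>M. \<forall>s\<in>{a..b}. \<forall>t\<in>{a..b}. \<bar>R j s t\<bar> \<le> M * \<bar>t - s\<bar> powr (\<gamma> + \<gamma>)" if "j \<in> Basis" for j
    using R[OF that] by (simp add: young_remainder_def)
  then obtain M where M: "\<And>j s t. j \<in> Basis \<Longrightarrow> s \<in> {a..b} \<Longrightarrow> t \<in> {a..b} \<Longrightarrow>
      \<bar>R j s t\<bar> \<le> M j * \<bar>t - s\<bar> powr (\<gamma> + \<gamma>)"
    by metis
  show "\<exists>M. \<forall>s t. a \<le> s \<longrightarrow> s \<le> t \<longrightarrow> t \<le> b \<longrightarrow>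
      \<bar>I t - I s - blinfun_apply (\<phi> (Y s)) (X t - X s) \<bullet> i\<bar> \<le> M * (t - s) powr (2 * \<gamma>)"
  proof (intro exI[of _ "\<Sum>j\<in>Basis. M j"] allI impI)
    fix s t assume st: "a \<le> s" "s \<le> t" "t \<le> b"
    hence st': "s \<in> {a..b}" "t \<in> {a..b}" by auto
    have "I t - I s = (\<Sum>j\<in>Basis. F j s * (G j t - G j s) - R j s t)"
      unfolding I sum_subtractf[symmetric]
      by (intro sum.cong refl young_integral_increment[OF \<gamma> R t0 st'])
    moreover have "blinfun_apply (\<phi> (Y s)) (X t - X s) \<bullet> i = (\<Sum>j\<in>Basis. F j s * (G j t - G j s))"
      unfolding F_def G_def inner_diff_left[symmetric] by (rule blinfun_apply_inner_expansion)
    ultimately have "I t - I s - blinfun_apply (\<phi> (Y s)) (X t - X s) \<bullet> i = - (\<Sum>j\<in>Basis. R j s t)"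
      by (simp only: sum_subtractf)
    hence "\<bar>I t - I s - blinfun_apply (\<phi> (Y s)) (X t - X s) \<bullet> i\<bar> \<le> (\<Sum>j\<in>Basis. \<bar>R j s t\<bar>)"
      using sum_abs[of "\<lambda>j. R j s t" Basis] by simp
    also have "\<dots> \<le> (\<Sum>j\<in>Basis. M j * (t - s) powr (2 * \<gamma>))"
    proof (rule sum_mono)
      fix j :: 'v assume "j \<in> Basis"
      from M[OF this st'] show "\<bar>R j s t\<bar> \<le> M j * (t - s) powr (2 * \<gamma>)"
        using st by (simp only: mult_2 abs_of_nonneg diff_ge_0_iff_ge)
    qed
    finally show "\<bar>I t - I s - blinfun_apply (\<phi> (Y s)) (X t - X s) \<bullet> i\<bar>
        \<le> (\<Sum>j\<in>Basis. M j) * (t - s) powr (2 * \<gamma>)"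
      by (simp add: sum_distrib_right)
  qed
qed

text \<open>Both sides prescribe the value at \<open>t0\<close> and, up to a superlinear error, the same increments.\<close>

lemma young_solution_iff_germ_solution:
  fixes X :: "real \<Rightarrow> 'v::euclidean_space"
  assumes \<gamma>: "1 / 2 < \<gamma>" and \<phi>: "lipschitz_bounded B \<phi>" and X: "increments_le \<gamma> C a b X" "0 \<le> C"
    and t0: "t0 \<in> {a..b}"
  shows "young_solution \<gamma> {a..b} t0 y \<phi> X Y \<longleftrightarrow>
    Y \<in> holder_space \<gamma> {a..b} \<and> Y t0 = y \<and> (\<exists>K. germ_solution \<gamma> \<phi> X K a b Y)"
proof (cases "Y \<in> holder_space \<gamma> {a..b}")
  case False
  then show ?thesis by (simp add: young_solution_def)
next
  case True
  define L where "L = holder_seminorm \<gamma> {a..b} Y"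
  have Y: "increments_le \<gamma> L a b Y" "0 \<le> L"
    using holder_space_increments_le[OF True] holder_seminorm_nonneg True by (auto simp: L_def holder_space_def)
  define I where "I i t = (\<Sum>j\<in>Basis.
      young_integral \<gamma> \<gamma> {a..b} (\<lambda>u. blinfun_apply (\<phi> (Y u)) j \<bullet> i) (\<lambda>u. X u \<bullet> j) t0 t)" for i t
  note facts = young_integral_sum_increment[OF \<gamma> \<phi> X Y t0, folded I_def]
  have I0: "I i t0 = 0" if "i \<in> Basis" for i using facts(1)[OF that] .
  obtain M where M: "\<And>i s t. i \<in> Basis \<Longrightarrow> a \<le> s \<Longrightarrow> s \<le> t \<Longrightarrow> t \<le> b \<Longrightarrow>
      \<bar>I i t - I i s - blinfun_apply (\<phi> (Y s)) (X t - X s) \<bullet> i\<bar> \<le> M i * (t - s) powr (2 * \<gamma>)"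
  proof -
    have "\<exists>M. \<forall>i\<in>Basis. \<forall>s t. a \<le> s \<longrightarrow> s \<le> t \<longrightarrow> t \<le> b \<longrightarrow>
        \<bar>I i t - I i s - blinfun_apply (\<phi> (Y s)) (X t - X s) \<bullet> i\<bar> \<le> M i * (t - s) powr (2 * \<gamma>)"
      by (intro bchoice ballI facts(2))
    thus thesis using that by blast
  qed
  have "(\<forall>t\<in>{a..b}. \<forall>i\<in>Basis. Y t \<bullet> i = y \<bullet> i + I i t) \<longleftrightarrow> Y t0 = y \<and> (\<exists>K. germ_solution \<gamma> \<phi> X K a b Y)"
  proof (intro iffI conjI)
    assume eq: "\<forall>t\<in>{a..b}. \<forall>i\<in>Basis. Y t \<bullet> i = y \<bullet> i + I i t"
    have eq': "Y t \<bullet> i = y \<bullet> i + I i t" if "t \<in> {a..b}" "i \<in> Basis" for t i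
      using eq that by blast
    show "Y t0 = y"
    proof (rule euclidean_eqI)
      fix i :: 'v assume i: "i \<in> Basis"
      show "Y t0 \<bullet> i = y \<bullet> i" unfolding eq'[OF t0 i] I0[OF i] by simp
    qed
    have "germ_solution \<gamma> \<phi> X (\<Sum>i\<in>Basis. M i) a b Y"
      unfolding germ_solution_def
    proof (intro allI impI)
      fix s t assume st: "a \<le> s" "s \<le> t" "t \<le> b"
      have "norm (euler_remainder \<phi> X Y s t) \<le> (\<Sum>i\<in>Basis. \<bar>euler_remainder \<phi> X Y s t \<bullet> i\<bar>)" by (rule norm_le_l1)
      also have "\<dots> \<le> (\<Sum>i\<in>Basis. M i * (t - s) powr (2 * \<gamma>))"
      proof (rule sum_mono)
        fix i :: 'v assume i: "i \<in> Basis"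
        have "euler_remainder \<phi> X Y s t \<bullet> i = I i t - I i s - blinfun_apply (\<phi> (Y s)) (X t - X s) \<bullet> i"
          using eq'[of t i] eq'[of s i] st i by (simp add: euler_remainder_def inner_diff_left)
        thus "\<bar>euler_remainder \<phi> X Y s t \<bullet> i\<bar> \<le> M i * (t - s) powr (2 * \<gamma>)"
          using M[OF i st] by (simp only:)
      qed
      finally show "norm (euler_remainder \<phi> X Y s t) \<le> (\<Sum>i\<in>Basis. M i) * (t - s) powr (2 * \<gamma>)"
        by (simp add: sum_distrib_right)
    qed
    thus "\<exists>K. germ_solution \<gamma> \<phi> X K a b Y" by blast
  next
    assume "Y t0 = y \<and> (\<exists>K. germ_solution \<gamma> \<phi> X K a b Y)"
    then obtain K where y: "Y t0 = y" and K: "germ_solution \<gamma> \<phi> X K a b Y" by blast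
    show "\<forall>t\<in>{a..b}. \<forall>i\<in>Basis. Y t \<bullet> i = y \<bullet> i + I i t"
    proof (intro ballI)
      fix t and i :: 'v assume t: "t \<in> {a..b}" and i: "i \<in> Basis"
      define E where "E t = Y t \<bullet> i - I i t" for t
      have "E t0 = E t"
      proof (rule superlinear_increments_const[where E = E and \<rho> = "2 * \<gamma>" and M = "K + M i", OF _ _ t0 t])
        fix s t assume st: "a \<le> s" "s \<le> t" "t \<le> b"
        have "\<bar>euler_remainder \<phi> X Y s t \<bullet> i\<bar> \<le> K * (t - s) powr (2 * \<gamma>)"
          using Basis_le_norm[OF i] germ_solutionD[OF K st] order_trans by blast
        moreover have "E t - E s = euler_remainder \<phi> X Y s t \<bullet> i
            - (I i t - I i s - blinfun_apply (\<phi> (Y s)) (X t - X s) \<bullet> i)"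
          by (simp add: E_def euler_remainder_def inner_diff_left)
        ultimately show "norm (E t - E s) \<le> (K + M i) * (t - s) powr (2 * \<gamma>)"
          using M[OF i st] by (simp add: distrib_right)
      qed (use \<gamma> in simp)
      thus "Y t \<bullet> i = y \<bullet> i + I i t" using y I0[OF i] by (simp add: E_def)
    qed
  qed
  thus ?thesis using True by (simp add: young_solution_def I_def)
qed

lemma young_solution_exists:
  fixes X :: "real \<Rightarrow> 'v::euclidean_space"
  assumes \<gamma>: "1 / 2 < \<gamma>" and \<phi>: "lipschitz_bounded B \<phi>" and X: "increments_le \<gamma> B a b X"
    and t0: "t0 \<in> {a..b}"
  shows "\<exists>Y. young_solution \<gamma> {a..b} t0 y \<phi> X Y"
proof -
  have \<gamma>0: "0 < \<gamma>" using \<gamma> by simp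
  note B = lipschitz_boundedD(3)[OF \<phi>]
  obtain Z K where Z: "Z t0 = y" "0 \<le> K" "germ_solution \<gamma> \<phi> X K a b Z"
    using germ_solution_exists[OF \<gamma> X \<phi>] t0 by (metis atLeastAtMost_iff)
  define Y where "Y = restrict Z {a..b}"
  have "germ_solution \<gamma> \<phi> X K a b Y"
    using Z(3) by (auto simp: germ_solution_def euler_remainder_def Y_def)
  moreover from germ_solution_increments[OF _ X \<phi> this Z(2)]
  have inc: "increments_le \<gamma> (B\<^sup>2 + K * (b - a) powr \<gamma>) a b Y" using \<gamma>0 by simp
  have "Y \<in> holder_space \<gamma> {a..b}"
    using increments_le_imp_continuous_on[OF \<gamma>0 inc] increments_le_imp_holder(1)[OF inc] Z(2)
    by (simp add: holder_space_def Y_def)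
  moreover have "Y t0 = y" using Z(1) t0 by (simp add: Y_def)
  ultimately show ?thesis
    using young_solution_iff_germ_solution[OF \<gamma> \<phi> X B t0] by blast
qed

lemma young_solution_stability:
  fixes a b \<gamma> \<theta> B :: real
  assumes \<gamma>: "1 / 2 < \<gamma>" and \<theta>: "0 < \<theta>" "\<theta> < 1" and \<rho>: "1 < (1 + \<theta>) * \<gamma>" and B: "1 \<le> B"
  obtains M where "0 \<le> M"
    "\<And>X X' y y' (\<phi> :: 'v::euclidean_space \<Rightarrow> 'v \<Rightarrow>\<^sub>L 'v) \<phi>' Y Y' t0 s t.
      X \<in> holder_space \<gamma> {a..b} \<Longrightarrow> X' \<in> holder_space \<gamma> {a..b} \<Longrightarrow> \<phi> \<in> C1_holder \<theta> \<Longrightarrow> \<phi>' \<in> C1_holder \<theta> \<Longrightarrow>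
      holder_seminorm \<gamma> {a..b} X \<le> B \<Longrightarrow> holder_seminorm \<gamma> {a..b} X' \<le> B \<Longrightarrow>
      C1_holder_norm \<theta> \<phi> \<le> B \<Longrightarrow> C1_holder_norm \<theta> \<phi>' \<le> B \<Longrightarrow>
      young_solution \<gamma> {a..b} t0 y \<phi> X Y \<Longrightarrow> young_solution \<gamma> {a..b} t0 y' \<phi>' X' Y' \<Longrightarrow>
      t0 \<in> {a..b} \<Longrightarrow> a \<le> s \<Longrightarrow> s \<le> t \<Longrightarrow> t \<le> b \<Longrightarrow>
      norm (Y t - Y' t) \<le> M * (holder_seminorm \<gamma> {a..b} (\<lambda>t. X t - X' t)
          + C1_holder_norm \<theta> (\<lambda>x. \<phi> x - \<phi>' x) + norm (y - y')) \<and>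
      norm ((Y t - Y' t) - (Y s - Y' s)) \<le> M * (holder_seminorm \<gamma> {a..b} (\<lambda>t. X t - X' t)
          + C1_holder_norm \<theta> (\<lambda>x. \<phi> x - \<phi>' x) + norm (y - y')) * (t - s) powr \<gamma>"
proof -
  show thesis
  proof (rule germ_solution_stability[where a = a and b = b and 'u = 'v and 'v = 'v, OF \<gamma> \<theta> \<rho> B], goal_cases)
    case (1 M)
    note M = 1
    show thesis
    proof (rule that[OF M(1)])
      fix X X' :: "real \<Rightarrow> 'v" and y y' and \<phi> \<phi>' :: "'v \<Rightarrow> 'v \<Rightarrow>\<^sub>L 'v" and Y Y' t0 s t
      assume X: "X \<in> holder_space \<gamma> {a..b}" "X' \<in> holder_space \<gamma> {a..b}"
        and \<phi>: "\<phi> \<in> C1_holder \<theta>" "\<phi>' \<in> C1_holder \<theta>"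
        and XB: "holder_seminorm \<gamma> {a..b} X \<le> B" "holder_seminorm \<gamma> {a..b} X' \<le> B"
        and \<phi>B: "C1_holder_norm \<theta> \<phi> \<le> B" "C1_holder_norm \<theta> \<phi>' \<le> B"
        and Y: "young_solution \<gamma> {a..b} t0 y \<phi> X Y" "young_solution \<gamma> {a..b} t0 y' \<phi>' X' Y'"
        and t0: "t0 \<in> {a..b}" and st: "a \<le> s" "s \<le> t" "t \<le> b"
      define dX where "dX = holder_seminorm \<gamma> {a..b} (\<lambda>t. X t - X' t)"
      define d\<phi> where "d\<phi> = C1_holder_norm \<theta> (\<lambda>x. \<phi> x - \<phi>' x)"
      note inc = holder_space_increments_le[OF X(1) XB(1)] holder_space_increments_le[OF X(2) XB(2)]
      note lip = C1_holder_lipschitz_bounded[OF \<phi>(1) \<phi>B(1)] C1_holder_lipschitz_bounded[OF \<phi>(2) \<phi>B(2)]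
      have dX_bounded: "holder_bounded \<gamma> {a..b} (\<lambda>t. X t - X' t)"
        using X by (intro holder_bounded_diff) (auto simp: holder_space_def)
      have dX0: "0 \<le> dX" unfolding dX_def by (rule holder_seminorm_nonneg[OF dX_bounded])
      have "lipschitz_bounded d\<phi> (\<lambda>x. \<phi> x - \<phi>' x)"
        unfolding d\<phi>_def by (rule C1_holder_lipschitz_bounded[OF C1_holder_diff[OF \<phi>] order_refl])
      hence d\<phi>0: "0 \<le> d\<phi>" by (rule lipschitz_boundedD(3))
      \<comment> \<open>One number has to bound the differences of both the drivers and the coefficients.\<close>
      have inc_diff: "increments_le \<gamma> (dX + d\<phi>) a b (\<lambda>t. X t - X' t)"
        by (rule holder_bounded_imp_increments_le[OF dX_bounded]) (use d\<phi>0 in \<open>simp add: dX_def\<close>)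
      have lip_diff: "lipschitz_bounded (dX + d\<phi>) (\<lambda>x. \<phi> x - \<phi>' x)"
        by (rule C1_holder_lipschitz_bounded[OF C1_holder_diff[OF \<phi>]]) (use dX0 in \<open>simp add: d\<phi>_def\<close>)
      have four: "four_point_holder \<theta> B \<phi>" using C1_holder_four_point[OF _ \<phi>(1) \<phi>B(1)] \<theta> by simp
      have B0: "0 \<le> B" using B by simp
      obtain K K' where germ: "germ_solution \<gamma> \<phi> X K a b Y" "germ_solution \<gamma> \<phi>' X' K' a b Y'"
        and init: "Y t0 = y" "Y' t0 = y'"
        using Y young_solution_iff_germ_solution[OF \<gamma> lip(1) inc(1) B0 t0]
          young_solution_iff_germ_solution[OF \<gamma> lip(2) inc(2) B0 t0] by blast
      from M(2)[OF inc inc_diff lip(1) four lip(2) lip_diff germ _ _ st, of t0] t0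
      show "norm (Y t - Y' t) \<le> M * (holder_seminorm \<gamma> {a..b} (\<lambda>t. X t - X' t)
            + C1_holder_norm \<theta> (\<lambda>x. \<phi> x - \<phi>' x) + norm (y - y')) \<and>
        norm ((Y t - Y' t) - (Y s - Y' s)) \<le> M * (holder_seminorm \<gamma> {a..b} (\<lambda>t. X t - X' t)
            + C1_holder_norm \<theta> (\<lambda>x. \<phi> x - \<phi>' x) + norm (y - y')) * (t - s) powr \<gamma>"
        by (simp add: init dX_def d\<phi>_def)
    qed
  qed
qed

lemma young_solution_ex1:
  fixes X :: "real \<Rightarrow> 'v::euclidean_space"
  assumes \<gamma>: "1 / 2 < \<gamma>" and \<theta>: "0 < \<theta>" "\<theta> < 1" and \<rho>: "1 < (1 + \<theta>) * \<gamma>"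
    and t0: "t0 \<in> {a..b}" and X: "X \<in> holder_space \<gamma> {a..b}" and \<phi>: "\<phi> \<in> C1_holder \<theta>"
  shows "\<exists>!Y. young_solution \<gamma> {a..b} t0 y \<phi> X Y"
proof -
  define B where "B = Max {1, holder_seminorm \<gamma> {a..b} X, C1_holder_norm \<theta> \<phi>}"
  have B: "1 \<le> B" "holder_seminorm \<gamma> {a..b} X \<le> B" "C1_holder_norm \<theta> \<phi> \<le> B" by (simp_all add: B_def)
  have "\<exists>Y. young_solution \<gamma> {a..b} t0 y \<phi> X Y"
    by (rule young_solution_exists[OF \<gamma> C1_holder_lipschitz_bounded[OF \<phi> B(3)]
          holder_space_increments_le[OF X B(2)] t0])
  moreover have "Y = Y'"
    if Y: "young_solution \<gamma> {a..b} t0 y \<phi> X Y" and Y': "young_solution \<gamma> {a..b} t0 y \<phi> X Y'" for Y Y'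
  proof (rule extensionalityI)
    show "Y \<in> extensional {a..b}" "Y' \<in> extensional {a..b}"
      using Y Y' by (auto simp: young_solution_def holder_space_def)
    fix t assume t: "t \<in> {a..b}"
    have zero: "holder_seminorm \<gamma> {a..b} (\<lambda>t. X t - X t) = 0" "C1_holder_norm \<theta> (\<lambda>x. \<phi> x - \<phi> x) = 0"
    proof -
      show "holder_seminorm \<gamma> {a..b} (\<lambda>t. X t - X t) = 0"
        using holder_bounded_seminorm_le[of 0 "{a..b}" "\<lambda>t. X t - X t" \<gamma>]
          holder_seminorm_nonneg[of \<gamma> "{a..b}" "\<lambda>t. X t - X t"] by simp
      have "fderiv (\<lambda>x. \<phi> x - \<phi> x) = (\<lambda>x. 0)"
        by (rule ext, rule fderiv_eqI) (simp add: zero_blinfun.rep_eq)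
      moreover have "holder_seminorm \<theta> UNIV (\<lambda>x::'v. 0 :: 'v \<Rightarrow>\<^sub>L 'v \<Rightarrow>\<^sub>L 'v) = 0"
        using holder_bounded_seminorm_le[of 0 UNIV "\<lambda>x::'v. 0 :: 'v \<Rightarrow>\<^sub>L 'v \<Rightarrow>\<^sub>L 'v" \<theta>]
          holder_seminorm_nonneg[of \<theta> UNIV "\<lambda>x::'v. 0 :: 'v \<Rightarrow>\<^sub>L 'v \<Rightarrow>\<^sub>L 'v"] by simp
      ultimately show "C1_holder_norm \<theta> (\<lambda>x. \<phi> x - \<phi> x) = 0" by (simp add: C1_holder_norm_def)
    qed
    show "Y t = Y' t"
    proof (rule young_solution_stability[where a = a and b = b and 'v = 'v, OF \<gamma> \<theta> \<rho> B(1)], goal_cases)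
      case (1 M)
      from 1(2)[OF X X \<phi> \<phi> B(2,2,3,3) Y Y' t0, of a t] t show ?case
        by (simp only: zero) simp
    qed
  qed
  ultimately show ?thesis by blast
qed

text \<open>The Lipschitz estimate for data in a ball of radius \<open>B\<close>; the constant of the theorem as a function of the four
norms arises by taking for \<open>B\<close> their maximum with \<open>1\<close>.\<close>

lemma young_flow_lipschitz:
  fixes a b \<gamma> \<theta> B :: real
  assumes \<gamma>: "1 / 2 < \<gamma>" and \<theta>: "0 < \<theta>" "\<theta> < 1" and \<rho>: "1 < (1 + \<theta>) * \<gamma>" and B: "1 \<le> B"
  shows "\<exists>M. \<forall>t0\<in>{a..b}. \<forall>X\<in>holder_space \<gamma> {a..b}. \<forall>X'\<in>holder_space \<gamma> {a..b}.
      \<forall>(y::'v::euclidean_space) y'. \<forall>\<phi>\<in>C1_holder \<theta>. \<forall>\<phi>'\<in>C1_holder \<theta>.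
        holder_seminorm \<gamma> {a..b} X \<le> B \<longrightarrow> holder_seminorm \<gamma> {a..b} X' \<le> B \<longrightarrow>
        C1_holder_norm \<theta> \<phi> \<le> B \<longrightarrow> C1_holder_norm \<theta> \<phi>' \<le> B \<longrightarrow>
        holder_seminorm \<gamma> {a..b} (\<lambda>t. young_flow \<gamma> {a..b} t0 y \<phi> X t - young_flow \<gamma> {a..b} t0 y' \<phi>' X' t)
          \<le> M * (holder_seminorm \<gamma> {a..b} (\<lambda>t. X t - X' t)
            + C1_holder_norm \<theta> (\<lambda>x. \<phi> x - \<phi>' x) + norm (y - y'))"
proof (rule young_solution_stability[where a = a and b = b and 'v = 'v, OF \<gamma> \<theta> \<rho> B], goal_cases)
  case (1 M)
  note M = 1
  show ?case
  proof (intro exI[of _ M] ballI allI impI)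
    fix t0 and X X' :: "real \<Rightarrow> 'v" and y y' :: 'v and \<phi> \<phi>' :: "'v \<Rightarrow> 'v \<Rightarrow>\<^sub>L 'v"
    assume t0: "t0 \<in> {a..b}" and X: "X \<in> holder_space \<gamma> {a..b}" "X' \<in> holder_space \<gamma> {a..b}"
      and \<phi>: "\<phi> \<in> C1_holder \<theta>" "\<phi>' \<in> C1_holder \<theta>"
      and bounds: "holder_seminorm \<gamma> {a..b} X \<le> B" "holder_seminorm \<gamma> {a..b} X' \<le> B"
        "C1_holder_norm \<theta> \<phi> \<le> B" "C1_holder_norm \<theta> \<phi>' \<le> B"
    define \<epsilon> where "\<epsilon> = holder_seminorm \<gamma> {a..b} (\<lambda>t. X t - X' t)
          + C1_holder_norm \<theta> (\<lambda>x. \<phi> x - \<phi>' x) + norm (y - y')"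
    define D where "D t = young_flow \<gamma> {a..b} t0 y \<phi> X t - young_flow \<gamma> {a..b} t0 y' \<phi>' X' t" for t
    have Y: "young_solution \<gamma> {a..b} t0 y \<phi> X (young_flow \<gamma> {a..b} t0 y \<phi> X)"
      "young_solution \<gamma> {a..b} t0 y' \<phi>' X' (young_flow \<gamma> {a..b} t0 y' \<phi>' X')"
      using young_solution_ex1[OF \<gamma> \<theta> \<rho> t0 X(1) \<phi>(1), THEN theI']
        young_solution_ex1[OF \<gamma> \<theta> \<rho> t0 X(2) \<phi>(2), THEN theI']
      unfolding young_flow_def by blast+
    have "0 \<le> holder_seminorm \<gamma> {a..b} (\<lambda>t. X t - X' t)"
      using X by (intro holder_seminorm_nonneg holder_bounded_diff) (auto simp: holder_space_def)
    moreover have "0 \<le> C1_holder_norm \<theta> (\<lambda>x. \<phi> x - \<phi>' x)"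
      by (rule lipschitz_boundedD(3)[OF C1_holder_lipschitz_bounded[OF C1_holder_diff[OF \<phi>] order_refl]])
    ultimately have \<epsilon>: "0 \<le> M * \<epsilon>" using M(1) by (simp add: \<epsilon>_def)
    have "increments_le \<gamma> (M * \<epsilon>) a b D"
      unfolding increments_le_def D_def \<epsilon>_def
      using M(2)[OF X \<phi> bounds Y t0] by blast
    from increments_le_imp_holder(2)[OF this \<epsilon>]
    show "holder_seminorm \<gamma> {a..b} (\<lambda>t. young_flow \<gamma> {a..b} t0 y \<phi> X t - young_flow \<gamma> {a..b} t0 y' \<phi>' X' t)
          \<le> M * (holder_seminorm \<gamma> {a..b} (\<lambda>t. X t - X' t)
            + C1_holder_norm \<theta> (\<lambda>x. \<phi> x - \<phi>' x) + norm (y - y'))"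
      by (simp add: D_def[abs_def] \<epsilon>_def)
  qed
qed

theorem proposition6:
  fixes a b \<gamma> \<theta> :: real
  assumes "\<gamma> > 1 / 2" and "0 < \<theta>" and "\<theta> < 1" and "(1 + \<theta>) * \<gamma> > 1"
  shows "(\<forall>t0\<in>{a..b}. \<forall>X\<in>holder_space \<gamma> {a..b}. \<forall>y::'v::euclidean_space. \<forall>\<phi>\<in>C1_holder \<theta>.
            \<exists>!Y. young_solution \<gamma> {a..b} t0 y \<phi> X Y) \<and>
         (\<exists>M :: real \<Rightarrow> real \<Rightarrow> real \<Rightarrow> real \<Rightarrow> real.
            \<forall>t0\<in>{a..b}. \<forall>X\<in>holder_space \<gamma> {a..b}. \<forall>X'\<in>holder_space \<gamma> {a..b}.
            \<forall>(y::'v) y'. \<forall>\<phi>\<in>C1_holder \<theta>. \<forall>\<phi>'\<in>C1_holder \<theta>.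
              holder_seminorm \<gamma> {a..b}
                (\<lambda>t. young_flow \<gamma> {a..b} t0 y \<phi> X t - young_flow \<gamma> {a..b} t0 y' \<phi>' X' t)
              \<le> M (holder_seminorm \<gamma> {a..b} X) (holder_seminorm \<gamma> {a..b} X')
                  (C1_holder_norm \<theta> \<phi>) (C1_holder_norm \<theta> \<phi>')
                * (holder_seminorm \<gamma> {a..b} (\<lambda>t. X t - X' t)
                   + C1_holder_norm \<theta> (\<lambda>x. \<phi> x - \<phi>' x) + norm (y - y')))"
proof (rule conjI)
  show "\<forall>t0\<in>{a..b}. \<forall>X\<in>holder_space \<gamma> {a..b}. \<forall>y::'v. \<forall>\<phi>\<in>C1_holder \<theta>.
      \<exists>!Y. young_solution \<gamma> {a..b} t0 y \<phi> X Y"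
    using young_solution_ex1[OF assms] by blast
  define size where "size p q r s = Max {1, p, q, r, s}" for p q r s :: real
  have size: "1 \<le> size p q r s" "p \<le> size p q r s" "q \<le> size p q r s" "r \<le> size p q r s" "s \<le> size p q r s"
    for p q r s by (simp_all add: size_def)
  define lipschitz_on_ball where "lipschitz_on_ball B M \<longleftrightarrow>
      (\<forall>t0\<in>{a..b}. \<forall>X\<in>holder_space \<gamma> {a..b}. \<forall>X'\<in>holder_space \<gamma> {a..b}.
      \<forall>(y::'v) y'. \<forall>\<phi>\<in>C1_holder \<theta>. \<forall>\<phi>'\<in>C1_holder \<theta>.
        holder_seminorm \<gamma> {a..b} X \<le> B \<longrightarrow> holder_seminorm \<gamma> {a..b} X' \<le> B \<longrightarrow>
        C1_holder_norm \<theta> \<phi> \<le> B \<longrightarrow> C1_holder_norm \<theta> \<phi>' \<le> B \<longrightarrow>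
        holder_seminorm \<gamma> {a..b} (\<lambda>t. young_flow \<gamma> {a..b} t0 y \<phi> X t - young_flow \<gamma> {a..b} t0 y' \<phi>' X' t)
          \<le> M * (holder_seminorm \<gamma> {a..b} (\<lambda>t. X t - X' t)
            + C1_holder_norm \<theta> (\<lambda>x. \<phi> x - \<phi>' x) + norm (y - y')))" for B M
  have "\<exists>M. lipschitz_on_ball B M" if "1 \<le> B" for B
    unfolding lipschitz_on_ball_def by (rule young_flow_lipschitz[OF assms that])
  then obtain M where M: "\<And>B. 1 \<le> B \<Longrightarrow> lipschitz_on_ball B (M B)" by metis
  show "\<exists>M :: real \<Rightarrow> real \<Rightarrow> real \<Rightarrow> real \<Rightarrow> real.
      \<forall>t0\<in>{a..b}. \<forall>X\<in>holder_space \<gamma> {a..b}. \<forall>X'\<in>holder_space \<gamma> {a..b}.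
      \<forall>(y::'v) y'. \<forall>\<phi>\<in>C1_holder \<theta>. \<forall>\<phi>'\<in>C1_holder \<theta>.
        holder_seminorm \<gamma> {a..b}
          (\<lambda>t. young_flow \<gamma> {a..b} t0 y \<phi> X t - young_flow \<gamma> {a..b} t0 y' \<phi>' X' t)
        \<le> M (holder_seminorm \<gamma> {a..b} X) (holder_seminorm \<gamma> {a..b} X')
            (C1_holder_norm \<theta> \<phi>) (C1_holder_norm \<theta> \<phi>')
          * (holder_seminorm \<gamma> {a..b} (\<lambda>t. X t - X' t)
             + C1_holder_norm \<theta> (\<lambda>x. \<phi> x - \<phi>' x) + norm (y - y'))"
    by (intro exI[of _ "\<lambda>p q r s. M (size p q r s)"] ballI allI
        M[OF size(1), unfolded lipschitz_on_ball_def, rule_format] size)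
qed

end
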